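(* Let $d\ge1$, $\alpha<1$, let $\mathbf F:S^{d-1}\to\mathbb R^d$ be continuously differentiable, and let $\mathbf G$ be a regularization function as in the context. Let $\mathbf y_*\in S^{d-1}$ be a fixed-point attractor of $d\tilde{\mathbf y}/ds=\mathbf F_s(\tilde{\mathbf y})$ (so $\mathbf F_s(\mathbf y_* )=\mathbf 0$) with $F_r(\mathbf y_* )<0$. Let $\mathbf x^\nu(t)$, $\nu>0$, be the solution of the $\nu$-regularized problem $\dot{\mathbf x}=\mathbf f^\nu(\mathbf x)$ with initial condition $\mathbf x^\nu(t_0)=\mathbf x_0=r_0\mathbf y_0$, where $r_0>0$ and $\mathbf y_0\in\mathcal B(\{\mathbf y_*\})$, and let $t_b$ be the (finite) blowup time of the solution of the singular system with the same initial condition. Assume that the regularization is locally expelling and that $\mathbf y_*^{esc}$ is in the basin of attraction of a fixed-point attractor $\mathcal A'=\{\mathbf y'_*\}$ of the same system on $S^{d-1}$, with $\mathbf F_s(\mathbf y'_* )=\mathbf 0$ and $F_r(\mathbf y'_* )>0$. Then the limit $\mathbf x(t)=\lim_{\nu\to0}\mathbf x^\nu(t)$ exists and is given by $$\mathbf x(t)=\left[(1-\alpha)F_r(\mathbf y'_* )(t-t_b)\right]^{\frac1{1-\alpha}}\mathbf y'_*,\qquad t>t_b.$$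
   Context: The singular system is $\dot{\mathbf x}=\mathbf f(\mathbf x)=r^\alpha\mathbf F(\mathbf y)$, $r=|\mathbf x|$, $\mathbf y=\mathbf x/r$. Decompose $\mathbf F(\mathbf y)=F_r(\mathbf y)\,\mathbf y+\mathbf F_s(\mathbf y)$ with $F_r(\mathbf y)=\mathbf F(\mathbf y)\cdot\mathbf y$. The blowup time $t_b$ is the maximal time such that the solution of the singular system with $\mathbf x(t_0)=\mathbf x_0$ satisfies $\mathbf x(t)\ne\mathbf 0$ on $[t_0,t_b)$. Regularization: $\mathbf G$ is an $\mathbb R^d$-valued function on the closed unit ball such that for every $\nu>0$ the field $$\mathbf f^\nu(\mathbf x)=\begin{cases}r^\alpha\mathbf F(\mathbf x/r),& r>\nu,\\ \nu^\alpha\mathbf G(\mathbf x/\nu),& r\le\nu,\end{cases}$$ is continuously differentiable on $\mathbb R^d$. Then $\mathbf x^\nu(t)$ exists and is unique globally in time. Rescaled problem: for $\mathbf y_{ent}\in S^{d-1}$ let $\mathbf X(\tau)$ be the unique global solution of $$\frac{d\mathbf X}{d\tau}=\begin{cases}R^\alpha\mathbf F(\mathbf X/R),&R>1,\\ \mathbf G(\mathbf X),&R\le1,\end{cases}\qquad \mathbf X(\tau_{ent})=\mathbf y_{ent},\quad R=|\mathbf X|,$$ with $\tau_{ent}=-\frac{1}{F_r(\mathbf y_* )(\alpha-1)}$. Such a solution is expelled if there is a finite $\tau_{esc}>\tau_{ent}$ with $R(\tau_{esc})=1$ and $R(\tau)>1$ for all $\tau>\tau_{esc}$; its exit point is $\mathbf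 y_{esc}=\mathbf X(\tau_{esc})$. The regularization is locally expelling if for all $\mathbf y_{ent}$ in some neighborhood of $\mathbf y_*$ in $S^{d-1}$ the solution is expelled and, additionally, $\mathbf y_{esc}$ depends smoothly (continuously differentiably) on $\mathbf y_{ent}$; $\mathbf y_*^{esc}$ denotes the exit point of the solution with $\mathbf y_{ent}=\mathbf y_*$. An attractor of $d\tilde{\mathbf y}/ds=\mathbf F_s(\tilde{\mathbf y})$ on $S^{d-1}$ is a nonempty compact invariant set $\mathcal A$ that has a neighborhood $U_0$ with $\bigcap_{s\ge0}U_s=\mathcal A$, where $U_s$ is the image of $U_0$ under the time-$s$ flow. Its basin $\mathcal B(\mathcal A)$ is the set of all points whose trajectories approach $\mathcal A$ asymptotically as $s\to\infty$. A fixed-point attractor is an attractor consisting of a single point. *)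

theory Defs
  imports "HOL-Analysis.Analysis"
begin

definition C1_on_open ::
  "'a::real_normed_vector set \<Rightarrow> ('a \<Rightarrow> 'b::real_normed_vector) \<Rightarrow> bool" where
  "C1_on_open U f \<longleftrightarrow> open U \<and>
     (\<exists>f' :: 'a \<Rightarrow> 'a \<Rightarrow>\<^sub>L 'b.
        (\<forall>x\<in>U. (f has_derivative blinfun_apply (f' x)) (at x)) \<and> continuous_on U f')"

text \<open>For maps on an arbitrary subset of Euclidean space, here the unit sphere and its
  relatively open subsets, continuous differentiability means that the map is locally the
  restriction of a continuously differentiable map on an open set. On submanifolds this
  is differentiability in charts.\<close>

definition C1_on_set ::
  "'a::real_normed_vector set \<Rightarrow> ('a \<Rightarrow> 'b::real_normed_vector) \<Rightarrow> bool" where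
  "C1_on_set S f \<longleftrightarrow>
     (\<forall>p\<in>S. \<exists>U g. p \<in> U \<and> C1_on_open U g \<and> (\<forall>x\<in>U \<inter> S. g x = f x))"

definition ode_solution_on ::
  "('a::real_normed_vector \<Rightarrow> 'a) \<Rightarrow> real set \<Rightarrow> (real \<Rightarrow> 'a) \<Rightarrow> bool" where
  "ode_solution_on f T x \<longleftrightarrow> (\<forall>t\<in>T. (x has_vector_derivative f (x t)) (at t within T))"

text \<open>Only the values of \<open>F\<close> on the unit sphere are used.
  The value of the singular field at the origin is an artefact of total functions; the
  solutions considered below avoid the origin.\<close>

definition singular_field ::
  "real \<Rightarrow> (real ^ 'n \<Rightarrow> real ^ 'n) \<Rightarrow> real ^ 'n \<Rightarrow> real ^ 'n" where
  "singular_field \<alpha> F x = (norm x powr \<alpha>) *\<^sub>R F (x /\<^sub>R norm x)"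

definition Fr :: "(real ^ 'n \<Rightarrow> real ^ 'n) \<Rightarrow> real ^ 'n \<Rightarrow> real" where
  "Fr F y = F y \<bullet> y"

definition Fs :: "(real ^ 'n \<Rightarrow> real ^ 'n) \<Rightarrow> real ^ 'n \<Rightarrow> real ^ 'n" where
  "Fs F y = F y - Fr F y *\<^sub>R y"

definition nonvanishing_solution ::
  "real \<Rightarrow> (real ^ 'n \<Rightarrow> real ^ 'n) \<Rightarrow> real \<Rightarrow> real ^ 'n \<Rightarrow> real \<Rightarrow> (real \<Rightarrow> real ^ 'n) \<Rightarrow> bool" where
  "nonvanishing_solution \<alpha> F t0 x0 T x \<longleftrightarrow>
     ode_solution_on (singular_field \<alpha> F) {t0..<T} x \<and> x t0 = x0 \<and>
     (\<forall>t\<in>{t0..<T}. x t \<noteq> 0)"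

definition is_blowup_time ::
  "real \<Rightarrow> (real ^ 'n \<Rightarrow> real ^ 'n) \<Rightarrow> real \<Rightarrow> real ^ 'n \<Rightarrow> real \<Rightarrow> bool" where
  "is_blowup_time \<alpha> F t0 x0 tb \<longleftrightarrow> t0 < tb \<and>
     (\<exists>x. nonvanishing_solution \<alpha> F t0 x0 tb x) \<and>
     (\<forall>T>tb. \<nexists>x. nonvanishing_solution \<alpha> F t0 x0 T x)"

definition sphere_trajectory ::
  "(real ^ 'n \<Rightarrow> real ^ 'n) \<Rightarrow> (real \<Rightarrow> real ^ 'n) \<Rightarrow> bool" where
  "sphere_trajectory F u \<longleftrightarrow> ode_solution_on (Fs F) UNIV u \<and> range u \<subseteq> sphere 0 1"

text \<open>For continuously differentiable \<open>F\<close> every point of the sphere lies on exactly one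
  trajectory, so that this is the image of \<open>U\<close> under the time-\<open>s\<close> flow.\<close>

definition flow_image ::
  "(real ^ 'n \<Rightarrow> real ^ 'n) \<Rightarrow> real \<Rightarrow> (real ^ 'n) set \<Rightarrow> (real ^ 'n) set" where
  "flow_image F s U = {u s | u. sphere_trajectory F u \<and> u 0 \<in> U}"

definition attractor :: "(real ^ 'n \<Rightarrow> real ^ 'n) \<Rightarrow> (real ^ 'n) set \<Rightarrow> bool" where
  "attractor F A \<longleftrightarrow>
     A \<noteq> {} \<and> compact A \<and> A \<subseteq> sphere 0 1 \<and> (\<forall>s\<ge>0. flow_image F s A = A) \<and>
     (\<exists>U0 V. U0 \<subseteq> sphere 0 1 \<and> openin (top_of_set (sphere 0 1)) V \<and> A \<subseteq> V \<and> V \<subseteq> U0 \<and>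
        (\<Inter>s\<in>{0..}. flow_image F s U0) = A)"

definition basin :: "(real ^ 'n \<Rightarrow> real ^ 'n) \<Rightarrow> (real ^ 'n) set \<Rightarrow> (real ^ 'n) set" where
  "basin F A = {y \<in> sphere 0 1.
     \<exists>u. sphere_trajectory F u \<and> u 0 = y \<and> ((\<lambda>s. infdist (u s) A) \<longlongrightarrow> 0) at_top}"

text \<open>Only the values of \<open>G\<close> on the closed unit ball are used.\<close>

definition reg_field ::
  "real \<Rightarrow> (real ^ 'n \<Rightarrow> real ^ 'n) \<Rightarrow> (real ^ 'n \<Rightarrow> real ^ 'n) \<Rightarrow> real \<Rightarrow> real ^ 'n \<Rightarrow> real ^ 'n" where
  "reg_field \<alpha> F G \<nu> x =
     (if norm x > \<nu> then (norm x powr \<alpha>) *\<^sub>R F (x /\<^sub>R norm x)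
      else (\<nu> powr \<alpha>) *\<^sub>R G (x /\<^sub>R \<nu>))"

definition regularization ::
  "real \<Rightarrow> (real ^ 'n \<Rightarrow> real ^ 'n) \<Rightarrow> (real ^ 'n \<Rightarrow> real ^ 'n) \<Rightarrow> bool" where
  "regularization \<alpha> F G \<longleftrightarrow> (\<forall>\<nu>>0. C1_on_open UNIV (reg_field \<alpha> F G \<nu>))"

definition rescaled_field ::
  "real \<Rightarrow> (real ^ 'n \<Rightarrow> real ^ 'n) \<Rightarrow> (real ^ 'n \<Rightarrow> real ^ 'n) \<Rightarrow> real ^ 'n \<Rightarrow> real ^ 'n" where
  "rescaled_field \<alpha> F G X =
     (if norm X > 1 then (norm X powr \<alpha>) *\<^sub>R F (X /\<^sub>R norm X) else G X)"

definition tau_ent :: "real \<Rightarrow> (real ^ 'n \<Rightarrow> real ^ 'n) \<Rightarrow> real ^ 'n \<Rightarrow> real" where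
  "tau_ent \<alpha> F ystar = - (1 / (Fr F ystar * (\<alpha> - 1)))"

text \<open>The solution started at \<open>yent\<close> at time \<open>\<tau>ent\<close> is expelled with exit point \<open>yesc\<close>.
  The escape time is unique if it exists, and so is the solution for a regularization \<open>G\<close>.\<close>

definition expelled_at ::
  "real \<Rightarrow> (real ^ 'n \<Rightarrow> real ^ 'n) \<Rightarrow> (real ^ 'n \<Rightarrow> real ^ 'n) \<Rightarrow> real \<Rightarrow>
     real ^ 'n \<Rightarrow> real ^ 'n \<Rightarrow> bool" where
  "expelled_at \<alpha> F G \<tau>ent yent yesc \<longleftrightarrow>
     (\<exists>X \<tau>esc. ode_solution_on (rescaled_field \<alpha> F G) UNIV X \<and> X \<tau>ent = yent \<and>
        \<tau>esc > \<tau>ent \<and> norm (X \<tau>esc) = 1 \<and> (\<forall>\<tau>>\<tau>esc. norm (X \<tau>) > 1) \<and>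
        yesc = X \<tau>esc)"

definition locally_expelling ::
  "real \<Rightarrow> (real ^ 'n \<Rightarrow> real ^ 'n) \<Rightarrow> (real ^ 'n \<Rightarrow> real ^ 'n) \<Rightarrow> real ^ 'n \<Rightarrow> bool" where
  "locally_expelling \<alpha> F G ystar \<longleftrightarrow>
     (\<exists>N yesc. openin (top_of_set (sphere 0 1)) N \<and> ystar \<in> N \<and>
        (\<forall>yent\<in>N. expelled_at \<alpha> F G (tau_ent \<alpha> F ystar) yent (yesc yent)) \<and>
        C1_on_set N yesc)"

end

theory Submission
  imports Defs
begin

text \<open>In logarithmic time \<open>s\<close> with \<open>dt = r\<^sup>1\<^sup>-\<^sup>\<alpha> ds\<close> the direction of a singular solution follows
  the flow of \<open>Fs\<close> on the sphere, and \<open>(ln r)' = Fr\<close>. Since \<open>Fr ystar < 0\<close>, the regularized solution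
  agrees with the singular one until it enters the ball of radius \<open>\<nu>\<close> at a time close to \<open>tb\<close> and in a
  direction close to \<open>ystar\<close>. Rescaled by \<open>\<nu>\<close> in space and by \<open>\<nu>\<^sup>1\<^sup>-\<^sup>\<alpha>\<close> in time it then follows the
  expelled solution from \<open>ystar\<close>; up to a fixed rescaled time at which that solution is outside the unit
  ball with direction near \<open>ystar'\<close>, the error tends to 0 by Gronwall. The attractor \<open>ystar'\<close> is
  Lyapunov stable, so the direction stays near \<open>ystar'\<close> from then on, and
  \<open>d(r\<^sup>1\<^sup>-\<^sup>\<alpha>)/dt = (1 - \<alpha>) Fr\<close> is nearly constant; the rescaled time takes only \<open>O(\<nu>\<^sup>1\<^sup>-\<^sup>\<alpha>)\<close> of
  physical time.\<close>

section \<open>Lipschitz differential equations\<close>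

text \<open>For the difference \<open>d\<close>, the quantity
  \<open>exp (- 2 * L * C * (s - a)) * (d s \<bullet> d s)\<close> has a nonpositive derivative;
  squaring avoids the kink of the norm at 0. The scalar factor \<open>c\<close> covers changes of
  time: it is a power of the radius in polar coordinates and -1 for reversed time.\<close>

lemma gronwall_lipschitz:
  fixes f :: "'a::real_inner \<Rightarrow> 'a" and z1 z2 :: "real \<Rightarrow> 'a"
  assumes L: "L-lipschitz_on UNIV f" and "a \<le> b"
    and z1: "\<And>s. s \<in> {a..b} \<Longrightarrow> (z1 has_vector_derivative c s *\<^sub>R f (z1 s)) (at s within {a..b})"
    and z2: "\<And>s. s \<in> {a..b} \<Longrightarrow> (z2 has_vector_derivative c s *\<^sub>R f (z2 s)) (at s within {a..b})"
    and C: "\<And>s. s \<in> {a..b} \<Longrightarrow> \<bar>c s\<bar> \<le> C"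
  shows "norm (z1 b - z2 b) \<le> exp (L * C * (b - a)) * norm (z1 a - z2 a)"
proof -
  define d where "d = (\<lambda>s. z1 s - z2 s)"
  define \<phi> where "\<phi> = (\<lambda>s. exp (- 2 * L * C * (s - a)) * (d s \<bullet> d s))"
  have L0: "0 \<le> L" using L by (rule lipschitz_on_nonneg)
  have cont: "continuous_on {a..b} d"
    unfolding d_def using z1 z2
    by (intro continuous_on_diff continuous_on_vector_derivative)
  have "\<phi> b \<le> \<phi> a"
  proof (rule DERIV_nonpos_imp_decreasing_open[OF \<open>a \<le> b\<close>])
    show "continuous_on {a..b} \<phi>"
      unfolding \<phi>_def by (intro continuous_intros cont)
    fix s assume s: "a < s" "s < b"
    let ?e = "c s *\<^sub>R f (z1 s) - c s *\<^sub>R f (z2 s)"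
    have "(d has_vector_derivative ?e) (at s)"
      using has_vector_derivative_diff[OF z1[of s] z2[of s]] s
      by (simp add: at_within_Icc_at d_def)
    then have dd: "(d has_derivative (\<lambda>h. h *\<^sub>R ?e)) (at s)"
      by (simp add: has_vector_derivative_def)
    have "((\<lambda>s. d s \<bullet> d s) has_real_derivative 2 * (d s \<bullet> ?e)) (at s)"
      using has_derivative_inner[OF dd dd]
      by (auto simp: has_field_derivative_def inner_commute algebra_simps
          elim!: has_derivative_eq_rhs)
    moreover have "((\<lambda>s. exp (- 2 * L * C * (s - a))) has_real_derivative
        exp (- 2 * L * C * (s - a)) * (- 2 * L * C)) (at s)"
      by (auto intro!: derivative_eq_intros)
    ultimately have "(\<phi> has_real_derivative
        exp (- 2 * L * C * (s - a)) * (2 * (d s \<bullet> ?e) - 2 * L * C * (d s \<bullet> d s))) (at s)"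
      unfolding \<phi>_def by (auto intro!: derivative_eq_intros simp: algebra_simps)
    moreover have "d s \<bullet> ?e \<le> L * C * (d s \<bullet> d s)"
    proof -
      have "d s \<bullet> ?e \<le> norm (d s) * norm ?e" by (rule norm_cauchy_schwarz)
      also have "norm ?e = \<bar>c s\<bar> * norm (f (z1 s) - f (z2 s))"
        by (metis norm_scaleR scaleR_right_diff_distrib)
      also have "norm (d s) * \<dots> \<le> norm (d s) * (C * (L * norm (d s)))"
        using lipschitz_on_normD[OF L, of "z1 s" "z2 s"] C[of s] s L0
        by (intro mult_left_mono mult_mono) (auto simp: d_def)
      finally show ?thesis by (simp add: power2_norm_eq_inner[symmetric] power2_eq_square algebra_simps)
    qed
    ultimately show "\<exists>y. (\<phi> has_real_derivative y) (at s) \<and> y \<le> 0"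
      by (intro exI conjI) (auto simp: mult_le_0_iff)
  qed
  then have "exp (- 2 * L * C * (b - a)) * (norm (d b))\<^sup>2 \<le> (norm (d a))\<^sup>2"
    by (simp add: \<phi>_def power2_norm_eq_inner)
  then have "exp (2 * L * C * (b - a)) * (exp (- 2 * L * C * (b - a)) * (norm (d b))\<^sup>2)
      \<le> exp (2 * L * C * (b - a)) * (norm (d a))\<^sup>2"
    by (rule mult_left_mono) simp
  then have "(norm (d b))\<^sup>2 \<le> (exp (L * C * (b - a)) * norm (d a))\<^sup>2"
    by (simp add: mult.assoc[symmetric] exp_add[symmetric] power_mult_distrib exp_double[symmetric])
  then show ?thesis
    unfolding d_def by (rule power2_le_imp_le) simp
qed

lemma integral_has_vector_derivative_halfline:
  fixes g :: "real \<Rightarrow> 'a::banach"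
  assumes "continuous_on {0..} g" "0 \<le> s"
  shows "((\<lambda>s. integral {0..s} g) has_vector_derivative g s) (at s within {0..})"
proof -
  have "((\<lambda>s. integral {0..s} g) has_vector_derivative g s) (at s within {0..s+1})"
    using assms by (intro integral_has_vector_derivative continuous_on_subset[OF assms(1)]) auto
  moreover have "at s within {0..s+1} = at s within {0..}"
    by (rule at_within_nhd[of _ "{..<s+1}"]) (use assms in auto)
  ultimately show ?thesis by simp
qed

text \<open>The Picard operator is a contraction on the whole half-line for functions weighted by
  \<open>exp (- 2 * K * t)\<close>.\<close>

lemma picard_lipschitz_forward:
  fixes H :: "'a::euclidean_space \<Rightarrow> 'a"
  assumes lip: "L-lipschitz_on UNIV H" and H0: "H 0 = 0"
  obtains u where "u 0 = q" "\<And>s. 0 \<le> s \<Longrightarrow> (u has_vector_derivative H (u s)) (at s within {0..})"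
proof -
  define K where "K = L + 1"
  have K: "K > 0" using lipschitz_on_nonneg[OF lip] by (simp add: K_def)
  have HK: "norm (H x - H y) \<le> K * norm (x - y)" for x y
    by (rule order_trans[OF lipschitz_on_normD[OF lip]]) (simp_all add: K_def algebra_simps)
  have contH: "continuous_on UNIV H" using lip by (rule lipschitz_on_continuous_on)
  define I where "I = (\<lambda>w t. integral {0..t} (\<lambda>s. H (exp (2 * K * s) *\<^sub>R (w s::'a))))"
  \<comment> \<open>Here \<open>w t\<close> stands for
    \<open>exp (- 2 * K * t) *\<^sub>R u t\<close>. Truncating at \<open>max 0 t\<close> makes
    \<open>P w\<close> constant on negative times, so that the operator acts on bounded continuous
    functions on the whole line.\<close>
  define P where "P = (\<lambda>w t. exp (- 2 * K *  max 0 t) *\<^sub>R (q + I w (max 0 t)))"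
  have contI: "continuous_on T (\<lambda>s. H (exp (2 * K * s) *\<^sub>R w s))" if "continuous_on UNIV w" for w T
    by (rule continuous_on_compose2[OF contH])
       (use that in \<open>auto intro!: continuous_intros intro: continuous_on_subset\<close>)
  have derI: "(I w has_vector_derivative H (exp (2 * K * s) *\<^sub>R w s)) (at s within {0..})"
    if "continuous_on UNIV w" "s \<ge> 0" for w s
    unfolding I_def using that by (intro integral_has_vector_derivative_halfline contI)
  \<comment> \<open>The integral of \<open>K * exp (2 * K * s)\<close> over \<open>{0..t}\<close> is
    at most \<open>exp (2 * K * t) / 2\<close>, so the weight leaves the contraction factor
    1/2.\<close>
  have bI: "norm (exp (- 2 * K * t) *\<^sub>R (I w t - I v t)) \<le> B / 2"
    if wv: "continuous_on UNIV w" "continuous_on UNIV v" and t: "0 \<le> t"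
      and B: "\<And>s. norm (w s - v s) \<le> B" for w v t B
  proof -
    have int: "(\<lambda>s. H (exp (2 * K * s) *\<^sub>R w s)) integrable_on {0..t}" if "continuous_on UNIV w" for w
      by (intro integrable_continuous_real contI that)
    have ev: "((\<lambda>s. K * exp (2 * K * s) * B) has_integral (exp (2 * K * t) * B / 2 - exp (2 * K * 0) * B / 2)) {0..t}"
      using t K by (intro fundamental_theorem_of_calculus)
        (auto simp flip: has_real_derivative_iff_has_vector_derivative intro!: derivative_eq_intros)
    have "norm (I w t - I v t) = norm (integral {0..t} (\<lambda>s. H (exp (2 * K * s) *\<^sub>R w s) - H (exp (2 * K * s) *\<^sub>R v s)))"
      unfolding I_def by (subst integral_diff) (auto intro!: int wv)
    also have "\<dots> \<le> integral {0..t} (\<lambda>s. K * exp (2 * K * s) * B)"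
    proof (rule integral_norm_bound_integral)
      fix s
      show "norm (H (exp (2 * K * s) *\<^sub>R w s) - H (exp (2 * K * s) *\<^sub>R v s)) \<le> K * exp (2 * K * s) * B"
        using B[of s] K
        by (intro order_trans[OF HK]) (simp add: mult_left_mono flip: scaleR_right_diff_distrib)
    qed (use ev in \<open>auto intro!: integrable_diff int wv\<close>)
    also have "\<dots> = (exp (2 * K * t) * B / 2 - B / 2)" using integral_unique[OF ev] by simp
    also have "\<dots> \<le> exp (2 * K * t) * B / 2"
      using order_trans[OF norm_ge_zero B[of 0]] by simp
    finally have "norm (I w t - I v t) \<le> exp (2 * K * t) * B / 2" .
    then have "exp (- (2 * K * t)) * norm (I w t - I v t) \<le> exp (- (2 * K * t)) * (exp (2 * K * t) * B / 2)"
      by (rule mult_left_mono) simp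
    also have "\<dots> = (exp (- (2 * K * t)) * exp (2 * K * t)) * B / 2" by (simp only: mult.assoc times_divide_eq_right)
    also have "\<dots> = B / 2" by (simp flip: exp_add)
    finally show ?thesis by simp
  qed
  have contP: "continuous_on UNIV (P w)" if "continuous_on UNIV w" for w
  proof -
    have "continuous_on {0..} (I w)"
      using derI[OF that] by (auto simp: continuous_on_eq_continuous_within intro: has_vector_derivative_continuous)
    then have "continuous_on UNIV (\<lambda>t. I w (max 0 t))"
      by (rule continuous_on_compose2) (auto intro!: continuous_intros)
    then show ?thesis unfolding P_def by (auto intro!: continuous_intros)
  qed
  have bP: "norm (P w t) \<le> norm q + B / 2"
    if w: "continuous_on UNIV w" and B: "\<And>s. norm (w s) \<le> B" for w t B
  proof -
    \<comment> \<open>Here \<open>H 0 = 0\<close> enters: comparing \<open>w\<close> with the zero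
      function turns the contraction estimate into boundedness of \<open>P w\<close>.\<close>
    have "I (\<lambda>_. 0) s = 0" for s by (simp add: I_def H0)
    then have 1: "norm (exp (- 2 * K *  max 0 t) *\<^sub>R I w (max 0 t)) \<le> B / 2"
      using bI[of w "\<lambda>_. 0" "max 0 t" B] w B by simp
    have "norm (exp (- 2 * K *  max 0 t) *\<^sub>R q) \<le> norm q"
      using K by (auto intro!: mult_left_le_one_le)
    with 1 show ?thesis
      unfolding P_def scaleR_right_distrib by (intro order_trans[OF norm_triangle_ineq]) simp
  qed
  define \<Phi> where "\<Phi> = (\<lambda>w. Bcontfun (P (apply_bcontfun w)))"
  have wc: "continuous_on UNIV (apply_bcontfun (w::real \<Rightarrow>\<^sub>C 'a))" for w
    using apply_bcontfun[of w] by (simp add: bcontfun_def)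
  have Pb: "P (apply_bcontfun w) \<in> bcontfun" for w
    using contP[OF wc, of w] bP[OF wc norm_bounded, of w]
    by (auto simp: bcontfun_def bounded_iff)
  have ap: "apply_bcontfun (\<Phi> w) = P (apply_bcontfun w)" for w
    unfolding \<Phi>_def by (rule Bcontfun_inverse[OF Pb])
  have "\<exists>!w. \<Phi> w = w"
  proof (rule banach_fix_type[where c = "1/2"], goal_cases)
    case 3
    have "dist (\<Phi> w) (\<Phi> v) \<le> 1/2 * dist w v" for w v
    proof (rule dist_bound)
      fix t
      have "norm (exp (- 2 * K * max 0 t) *\<^sub>R (I w (max 0 t) - I v (max 0 t))) \<le> dist w v / 2"
        by (rule bI) (auto intro!: wc simp: dist_bounded simp flip: dist_norm)
      then show "dist (apply_bcontfun (\<Phi> w) t) (apply_bcontfun (\<Phi> v) t) \<le> 1/2 * dist w v"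
        unfolding ap P_def dist_norm by (simp add: algebra_simps)
    qed
    then show ?case by blast
  qed auto
  then obtain w where w: "\<Phi> w = w" by auto
  then have wP: "w t = P w t" for t using ap[of w] by simp
  define u where "u = (\<lambda>t. exp (2 * K * t) *\<^sub>R w t)"
  have u: "u t = q + I w t" if "t \<ge> 0" for t
    unfolding u_def wP[of t] P_def using that by (simp add: exp_minus)
  show thesis
  proof
    show "u 0 = q" using u[of 0] by (simp add: I_def)
    fix s :: real assume s: "0 \<le> s"
    have "((\<lambda>t. q + I w t) has_vector_derivative H (u s)) (at s within {0..})"
      using derI[OF wc s] by (auto intro!: derivative_eq_intros simp: u_def)
    then show "(u has_vector_derivative H (u s)) (at s within {0..})"
      by (rule has_vector_derivative_transform[rotated 2]) (use s u in auto)
  qed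
qed

lemma picard_lipschitz:
  fixes H :: "'a::euclidean_space \<Rightarrow> 'a"
  assumes lip: "L-lipschitz_on UNIV H" and H0: "H 0 = 0"
  obtains u where "u 0 = q" "\<And>s. (u has_vector_derivative H (u s)) (at s)"
proof -
  obtain u where u: "u 0 = q" "\<And>s. 0 \<le> s \<Longrightarrow> (u has_vector_derivative H (u s)) (at s within {0..})"
    using picard_lipschitz_forward[OF lip H0] by blast
  \<comment> \<open>For negative times, the forward solution for \<open>- H\<close> is run backwards
    and glued to \<open>u\<close> at 0, where the two one-sided derivatives agree.\<close>
  have "L-lipschitz_on UNIV (\<lambda>x. - H x)" using lip by simp
  then obtain v where v: "v 0 = q" "\<And>s. 0 \<le> s \<Longrightarrow> (v has_vector_derivative - H (v s)) (at s within {0..})"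
    by (rule picard_lipschitz_forward[where q = q]) (auto simp: H0)
  have v': "((\<lambda>s. v (- s)) has_vector_derivative H (v (- s))) (at s within {..0})" if "s \<le> 0" for s
  proof -
    have "uminus ` {..0} = {0::real..}" by (auto simp: image_iff intro: bexI[of _ "- x" for x])
    with vector_diff_chain_within[of "\<lambda>s. - s" "-1" s "{..0}" v "- H (v (- s))"] v(2)[of "- s"] that
      has_vector_derivative_minus[OF has_vector_derivative_id, of "at s within {..0}"]
    show ?thesis by (simp add: o_def)
  qed
  define w where "w = (\<lambda>s. if s \<in> {0..} then u s else v (- s))"
  show thesis
  proof
    show "w 0 = q" by (simp add: w_def u)
    fix s
    have "(w has_vector_derivative (if s \<in> {0..} then H (u s) else H (v (- s)))) (at s within UNIV)"
      unfolding w_def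
      by (rule has_vector_derivative_If_within_closures[where T = "{..0}"])
         (use u v v' in \<open>auto simp: Un_absorb2 Int_absorb2\<close>)
    then show "(w has_vector_derivative H (w s)) (at s)" by (auto simp: w_def split: if_splits)
  qed
qed

section \<open>The regularized fields\<close>

lemma reg_field_scale:
  assumes "\<nu> > 0"
  shows "reg_field \<alpha> F G \<nu> x = (\<nu> powr \<alpha>) *\<^sub>R reg_field \<alpha> F G 1 (x /\<^sub>R \<nu>)"
proof -
  have "\<nu> powr \<alpha> * (norm x / \<nu>) powr \<alpha> = norm x powr \<alpha>"
    using assms by (simp flip: powr_mult)
  then show ?thesis
    using assms by (auto simp: reg_field_def field_simps)
qed

lemma rescaled_field_eq_reg_field: "rescaled_field \<alpha> F G = reg_field \<alpha> F G 1"
  by (auto simp: fun_eq_iff rescaled_field_def reg_field_def)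

lemma reg_field_homogeneous:
  assumes "k > 0" "norm x > 1" "norm x > k"
  shows "reg_field \<alpha> F G 1 x = (k powr \<alpha>) *\<^sub>R reg_field \<alpha> F G 1 (x /\<^sub>R k)"
proof -
  have "k powr \<alpha> * (norm x / k) powr \<alpha> = norm x powr \<alpha>"
    using assms by (simp flip: powr_mult)
  then show ?thesis using assms by (auto simp: reg_field_def field_simps)
qed

lemma C1_on_open_UNIV_D:
  assumes "C1_on_open UNIV f"
  obtains f' where "\<And>x. (f has_derivative blinfun_apply (f' x)) (at x)" "continuous_on UNIV f'"
  using assms by (auto simp: C1_on_open_def)

text \<open>Outside the unit ball the field is homogeneous of degree \<open>\<alpha>\<close>, so its derivative is
  homogeneous of degree \<open>\<alpha> - 1 < 0\<close> there and is bounded by its values near the ball of radius 2.\<close>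

lemma reg_field_1_lipschitz:
  fixes F G :: "real^'n \<Rightarrow> real^'n"
  assumes "\<alpha> < 1" and reg: "regularization \<alpha> F G"
  obtains L where "L-lipschitz_on UNIV (reg_field \<alpha> F G 1)"
proof -
  let ?f = "reg_field \<alpha> F G 1"
  obtain f' where f': "\<And>x. (?f has_derivative blinfun_apply (f' x)) (at x)" "continuous_on UNIV f'"
    using reg C1_on_open_UNIV_D[of ?f] by (auto simp: regularization_def)
  have "compact (f' ` cball 0 2)"
    by (intro compact_continuous_image continuous_on_subset[OF f'(2)]) auto
  then obtain B where B: "\<And>x. norm x \<le> 2 \<Longrightarrow> norm (f' x) \<le> B"
    using compact_imp_bounded bounded_iff by (metis image_eqI mem_cball_0)
  have "\<exists>D. (?f has_derivative D) (at x) \<and> onorm D \<le> B" for x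
  proof (cases "norm x \<le> 2")
    case True
    then show ?thesis using f' B by (metis norm_blinfun.rep_eq)
  next
    case False
    \<comment> \<open>The point \<open>x /\<^sub>R k\<close> has norm 2: it lies in the compact ball
      on which \<open>B\<close> bounds the derivative, and strictly outside the unit ball, so that
      homogeneity holds in a neighbourhood of \<open>x\<close>.\<close>
    define k where "k = norm x / 2"
    have k: "k > 1" using False by (simp add: k_def)
    have n: "norm (x /\<^sub>R k) = 2" using False by (cases "x = 0") (simp_all add: k_def)
    let ?D = "\<lambda>h. (k powr \<alpha>) *\<^sub>R blinfun_apply (f' (x /\<^sub>R k)) (h /\<^sub>R k)"
    have "((\<lambda>x. (k powr \<alpha>) *\<^sub>R ?f (x /\<^sub>R k)) has_derivative ?D) (at x)"
      by (intro has_derivative_scaleR_right has_derivative_compose[of "\<lambda>x. x /\<^sub>R k" "\<lambda>h. h /\<^sub>R k", OF _ f'(1)]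
            has_derivative_ident)
    then have "(?f has_derivative ?D) (at x)"
    proof (rule has_derivative_transform_within_open)
      show "open {z::real^'n. norm z > 1 \<and> norm z > k}"
        by (intro open_Collect_conj open_Collect_less continuous_intros)
      show "x \<in> {z. norm z > 1 \<and> norm z > k}" using False by (auto simp: k_def)
      show "(k powr \<alpha>) *\<^sub>R ?f (z /\<^sub>R k) = ?f z" if "z \<in> {z. norm z > 1 \<and> norm z > k}" for z
        using that k by (intro reg_field_homogeneous[symmetric]) auto
    qed
    moreover have "onorm ?D \<le> B"
    proof (rule onorm_le)
      fix h
      have "norm (?D h) = k powr (\<alpha> - 1) * norm (blinfun_apply (f' (x /\<^sub>R k)) h)"
        using k by (simp add: blinfun.scaleR_right powr_diff divide_inverse)
      also have "\<dots> \<le> 1 * (B * norm h)"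
      proof (intro mult_mono)
        show "k powr (\<alpha> - 1) \<le> 1" using k assms(1) powr_mono[of "\<alpha> - 1" 0 k] by simp
        have "norm (f' (x /\<^sub>R k)) \<le> B" using B n by simp
        then show "norm (blinfun_apply (f' (x /\<^sub>R k)) h) \<le> B * norm h"
          by (meson mult_right_mono norm_blinfun norm_ge_zero order_trans)
      qed auto
      finally show "norm (?D h) \<le> B * norm h" by simp
    qed
    ultimately show ?thesis by blast
  qed
  then obtain D where D: "\<And>x. (?f has_derivative D x) (at x)" "\<And>x. onorm (D x) \<le> B" by metis
  show thesis
  proof (rule that, rule lipschitz_onI)
    show "dist (?f x) (?f y) \<le> B * dist x y" for x y
      unfolding dist_norm using D by (intro differentiable_bound[of UNIV ?f D]) auto
    show "0 \<le> B" using order_trans[OF norm_ge_zero B[of 0]] by simp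
  qed
qed

lemma reg_field_lipschitz:
  fixes F G :: "real^'n \<Rightarrow> real^'n"
  assumes "\<alpha> < 1" and reg: "regularization \<alpha> F G" and \<nu>: "\<nu> > 0"
  obtains L where "L-lipschitz_on UNIV (reg_field \<alpha> F G \<nu>)"
proof -
  obtain L where L: "L-lipschitz_on UNIV (reg_field \<alpha> F G 1)"
    using reg_field_1_lipschitz assms by blast
  have 1: "(inverse \<nu>)-lipschitz_on UNIV (\<lambda>x::real^'n. x /\<^sub>R \<nu>)"
    using lipschitz_on_cmult_nonneg[OF lipschitz_on_id, of "inverse \<nu>"] \<nu> by simp
  have "(\<nu> powr \<alpha> * (L * inverse \<nu>))-lipschitz_on UNIV (\<lambda>x. (\<nu> powr \<alpha>) *\<^sub>R reg_field \<alpha> F G 1 (x /\<^sub>R \<nu>))"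
    by (intro lipschitz_on_cmult_nonneg lipschitz_on_compose2[OF 1] lipschitz_on_subset[OF L]) auto
  then show thesis using that reg_field_scale[OF \<nu>, of \<alpha> F G] by (metis (no_types, lifting) ext)
qed

text \<open>On the boundary sphere \<open>norm x = \<nu>\<close> the regularized field is defined
  through \<open>G\<close>; its continuity recovers the singular value there as the limit along the
  ray from outside.\<close>

lemma reg_field_eq_singular_field:
  assumes reg: "regularization \<alpha> F G" and \<nu>: "\<nu> > 0" and x: "norm x \<ge> \<nu>"
  shows "reg_field \<alpha> F G \<nu> x = singular_field \<alpha> F x"
proof -
  let ?f = "reg_field \<alpha> F G \<nu>"
  have "isCont ?f x"
    using reg \<nu> by (metis C1_on_open_UNIV_D has_derivative_continuous regularization_def)
  then have "((\<lambda>c. ?f (c *\<^sub>R x)) \<longlongrightarrow> ?f (1 *\<^sub>R x)) (at_right 1)"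
    by (intro isCont_tendsto_compose[of _ ?f] tendsto_intros) auto
  moreover have "((\<lambda>c. ?f (c *\<^sub>R x)) \<longlongrightarrow> singular_field \<alpha> F x) (at_right 1)"
  proof (rule Lim_transform_eventually)
    have "norm x \<noteq> 0" using x \<nu> by auto
    then show "((\<lambda>c. ((c * norm x) powr \<alpha>) *\<^sub>R F (x /\<^sub>R norm x)) \<longlongrightarrow> singular_field \<alpha> F x) (at_right 1)"
      by (auto simp: singular_field_def intro!: tendsto_eq_intros)
    show "\<forall>\<^sub>F c in at_right 1. ((c * norm x) powr \<alpha>) *\<^sub>R F (x /\<^sub>R norm x) = ?f (c *\<^sub>R x)"
    proof (rule eventually_at_right_less[THEN eventually_mono])
      fix c :: real assume c: "1 < c"
      then have "1 * norm x < c * norm x" using x \<nu> by (intro mult_strict_right_mono) auto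
      then have "c * norm x > \<nu>" using x by linarith
      moreover have n: "norm (c *\<^sub>R x) = c * norm x" using c by simp
      moreover have d: "(c *\<^sub>R x) /\<^sub>R (c * norm x) = x /\<^sub>R norm x" using c by simp
      ultimately show "((c * norm x) powr \<alpha>) *\<^sub>R F (x /\<^sub>R norm x) = ?f (c *\<^sub>R x)"
        unfolding reg_field_def n d by simp
    qed
  qed
  ultimately have "?f (1 *\<^sub>R x) = singular_field \<alpha> F x" by (rule tendsto_unique[OF trivial_limit_at_right_real])
  then show ?thesis by simp
qed

section \<open>Lipschitz fields on the sphere and their extension to the whole space\<close>

lemma F_eq_reg_field:
  assumes "regularization \<alpha> F G" "y \<in> sphere 0 1"
  shows "F y = reg_field \<alpha> F G 1 y"
  using reg_field_eq_singular_field[OF assms(1), of 1 y] assms(2) by (simp add: singular_field_def)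

text \<open>On the sphere \<open>F\<close> is the restriction of the globally Lipschitz field
  \<open>reg_field \<alpha> F G 1\<close>.\<close>

lemma F_lipschitz_on_sphere:
  assumes "\<alpha> < 1" "regularization \<alpha> F G"
  obtains L where "L-lipschitz_on (sphere 0 1) F"
proof -
  obtain L where L: "L-lipschitz_on UNIV (reg_field \<alpha> F G 1)"
    using reg_field_1_lipschitz[OF assms] .
  have "L-lipschitz_on (sphere 0 1) F"
    by (rule lipschitz_on_transform[OF lipschitz_on_subset[OF L subset_UNIV]]) (simp add: F_eq_reg_field[OF assms(2)])
  then show thesis by (rule that)
qed

lemma Fr_continuous_on_sphere:
  assumes "L-lipschitz_on (sphere 0 1) F"
  shows "continuous_on (sphere 0 1) (Fr F)"
  using lipschitz_on_continuous_on[OF assms] unfolding Fr_def by (intro continuous_intros)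

lemma norm_le_if_lipschitz_on_sphere:
  fixes F :: "real^'n \<Rightarrow> real^'n"
  assumes "L-lipschitz_on (sphere 0 1) F"
  obtains M where "\<And>y. y \<in> sphere 0 1 \<Longrightarrow> norm (F y) \<le> M" "M \<ge> 0"
proof -
  have "bounded (F ` sphere 0 1)"
    by (intro compact_imp_bounded compact_continuous_image lipschitz_on_continuous_on[OF assms]) auto
  then show thesis using that unfolding bounded_pos by (metis imageI order_less_imp_le)
qed

lemma Fs_orthogonal: "y \<in> sphere 0 1 \<Longrightarrow> Fs F y \<bullet> y = 0"
  by (simp add: Fs_def Fr_def inner_diff_left norm_eq_sqrt_inner)

lemma Fs_lipschitz_on_sphere:
  fixes F :: "real^'n \<Rightarrow> real^'n"
  assumes L: "L-lipschitz_on (sphere 0 1) F"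
  obtains K where "K-lipschitz_on (sphere 0 1) (Fs F)"
proof -
  obtain M where M: "\<And>y. y \<in> sphere 0 1 \<Longrightarrow> norm (F y) \<le> M" "M \<ge> 0"
    using norm_le_if_lipschitz_on_sphere[OF L] by blast
  have L0: "0 \<le> L" using L by (rule lipschitz_on_nonneg)
  have "(2 * L + 2 * M)-lipschitz_on (sphere 0 1) (Fs F)"
  proof (rule lipschitz_onI)
    fix x y :: "real^'n" assume xy: "x \<in> sphere 0 1" "y \<in> sphere 0 1"
    have d: "norm (F x - F y) \<le> L * norm (x - y)" using lipschitz_on_normD[OF L xy] .
    \<comment> \<open>The change of the radial part is split so that each summand varies one of the
      three factors in \<open>(F y \<bullet> y) *\<^sub>R y\<close>.\<close>
    have "Fs F x - Fs F y = (F x - F y) - (((F x - F y) \<bullet> x) *\<^sub>R x + (F y \<bullet> (x - y)) *\<^sub>R x + (F y \<bullet> y) *\<^sub>R (x - y))"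
      by (simp add: Fs_def Fr_def algebra_simps inner_diff_left inner_diff_right)
    also have "norm \<dots> \<le> norm (F x - F y) + (\<bar>(F x - F y) \<bullet> x\<bar> + \<bar>F y \<bullet> (x - y)\<bar> + \<bar>F y \<bullet> y\<bar> * norm (x - y))"
      using xy by (intro order_trans[OF norm_triangle_ineq4] add_mono order_trans[OF norm_triangle_ineq] order_refl) auto
    also have "\<bar>(F x - F y) \<bullet> x\<bar> \<le> L * norm (x - y)"
      using Cauchy_Schwarz_ineq2[of "F x - F y" x] xy d by auto
    also have "\<bar>F y \<bullet> (x - y)\<bar> \<le> M * norm (x - y)"
      using Cauchy_Schwarz_ineq2[of "F y" "x - y"] M(1)[OF xy(2)] by (meson mult_right_mono norm_ge_zero order_trans)
    also have "\<bar>F y \<bullet> y\<bar> * norm (x - y) \<le> M * norm (x - y)"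
      using Cauchy_Schwarz_ineq2[of "F y" y] M(1)[OF xy(2)] xy by (intro mult_right_mono) auto
    finally show "dist (Fs F x) (Fs F y) \<le> (2 * L + 2 * M) * dist x y"
      using d by (simp add: dist_norm algebra_simps)
  qed (use L0 M in simp)
  then show thesis by (rule that)
qed

text \<open>The Picard and Gronwall lemmas need a Lipschitz field on the whole space. Homogeneity of
  degree one keeps the extension Lipschitz near the origin and at infinity alike.\<close>

lemma homogeneous_extension_lipschitz:
  fixes g :: "real^'n \<Rightarrow> real^'n"
  assumes L: "L-lipschitz_on (sphere 0 1) g"
  obtains K where "K-lipschitz_on UNIV (\<lambda>x. norm x *\<^sub>R g (x /\<^sub>R norm x))"
proof -
  obtain M where M: "\<And>y. y \<in> sphere 0 1 \<Longrightarrow> norm (g y) \<le> M" "M \<ge> 0"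
    using norm_le_if_lipschitz_on_sphere[OF L] by blast
  have L0: "0 \<le> L" using L by (rule lipschitz_on_nonneg)
  let ?h = "\<lambda>x. norm x *\<^sub>R g (x /\<^sub>R norm x)"
  have "(2 * L + M)-lipschitz_on UNIV ?h"
  proof (rule lipschitz_onI)
    fix x y :: "real^'n"
    show "dist (?h x) (?h y) \<le> (2 * L + M) * dist x y"
    proof (cases "x = 0 \<or> y = 0")
      case True
      have "norm (?h z) \<le> (2 * L + M) * norm z" for z
      proof (cases "z = 0")
        case False
        then have "norm (g (z /\<^sub>R norm z)) \<le> 2 * L + M" using M(1)[of "z /\<^sub>R norm z"] L0 by simp
        then have "norm z * norm (g (z /\<^sub>R norm z)) \<le> norm z * (2 * L + M)"
          by (rule mult_left_mono) simp
        then show ?thesis by (simp add: mult.commute)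
      qed auto
      with True show ?thesis by (auto simp: dist_norm)
    next
      case False
      define a where "a = x /\<^sub>R norm x"
      define b where "b = y /\<^sub>R norm y"
      have ab: "a \<in> sphere 0 1" "b \<in> sphere 0 1" using False by (auto simp: a_def b_def)
      \<comment> \<open>The directions differ by at most \<open>2 * norm (x - y) / norm x\<close>;
        the factor \<open>norm x\<close> of the extension cancels this denominator.\<close>
      have "norm x *\<^sub>R (a - b) = (x - y) - (norm x - norm y) *\<^sub>R b"
        using False by (simp add: a_def b_def algebra_simps)
      also have "norm \<dots> \<le> norm (x - y) + \<bar>norm x - norm y\<bar>"
        using ab by (intro order_trans[OF norm_triangle_ineq4]) simp
      also have "\<dots> \<le> 2 * norm (x - y)" using norm_triangle_ineq3[of x y] by simp
      finally have 1: "norm x * norm (a - b) \<le> 2 * norm (x - y)" by simp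
      have "?h x - ?h y = norm x *\<^sub>R (g a - g b) + (norm x - norm y) *\<^sub>R g b"
        by (simp add: a_def b_def algebra_simps)
      also have "norm \<dots> \<le> norm x * norm (g a - g b) + \<bar>norm x - norm y\<bar> * norm (g b)"
        by (intro order_trans[OF norm_triangle_ineq]) simp
      also have "\<dots> \<le> norm x * (L * norm (a - b)) + norm (x - y) * M"
        using lipschitz_on_normD[OF L ab] M(1)[OF ab(2)] norm_triangle_ineq3[of x y]
        by (intro add_mono mult_mono order_refl) auto
      also have "\<dots> \<le> (2 * L + M) * norm (x - y)"
        using mult_left_mono[OF 1 L0] by (simp add: algebra_simps)
      finally show ?thesis by (simp add: dist_norm)
    qed
  qed (use L0 M in simp)
  then show thesis by (rule that)
qed

section \<open>The flow on the sphere\<close>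

text \<open>Since \<open>Fs F\<close> is tangential, its extension \<open>H\<close> is orthogonal to
  the position vector everywhere. The Picard solution therefore conserves its norm and stays on the
  sphere, where \<open>H\<close> is \<open>Fs F\<close>.\<close>

lemma sphere_trajectory_exists:
  fixes F :: "real^'n \<Rightarrow> real^'n"
  assumes L: "L-lipschitz_on (sphere 0 1) F" and q: "q \<in> sphere 0 1"
  obtains u where "sphere_trajectory F u" "u 0 = q"
proof -
  define H where "H = (\<lambda>x. norm x *\<^sub>R Fs F (x /\<^sub>R norm x))"
  obtain K0 where "K0-lipschitz_on (sphere 0 1) (Fs F)" using Fs_lipschitz_on_sphere[OF L] .
  then obtain K where "K-lipschitz_on UNIV H"
    unfolding H_def by (rule homogeneous_extension_lipschitz)
  then obtain u where u: "u 0 = q" "\<And>s. (u has_vector_derivative H (u s)) (at s)"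
    by (rule picard_lipschitz) (auto simp: H_def)
  have orth: "H x \<bullet> x = 0" for x
  proof (cases "x = 0")
    case False
    then have "Fs F (x /\<^sub>R norm x) \<bullet> (x /\<^sub>R norm x) = 0" by (intro Fs_orthogonal) simp
    then show ?thesis using False by (simp add: H_def)
  qed (simp add: H_def)
  have "((\<lambda>s. u s \<bullet> u s) has_real_derivative 0) (at s)" for s
  proof -
    have "(u has_derivative (\<lambda>h. h *\<^sub>R H (u s))) (at s)" using u(2) by (simp add: has_vector_derivative_def)
    from has_derivative_inner[OF this this] show ?thesis
      using orth by (auto simp: has_field_derivative_def inner_commute elim!: has_derivative_eq_rhs)
  qed
  then have "u s \<bullet> u s = u 0 \<bullet> u 0" for s
    using DERIV_isconst_all[of "\<lambda>s. u s \<bullet> u s" s 0] by blast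
  then have n: "norm (u s) = 1" for s using q u(1) by (simp add: norm_eq_sqrt_inner)
  have "sphere_trajectory F u"
    using u(2) n by (auto simp: sphere_trajectory_def ode_solution_on_def H_def)
  then show thesis using that u(1) by blast
qed

lemma sphere_trajectoryD:
  assumes "sphere_trajectory F u"
  shows "(u has_vector_derivative Fs F (u s)) (at s)" and "u s \<in> sphere 0 1"
  using assms unfolding sphere_trajectory_def ode_solution_on_def by blast+

lemma sphere_trajectory_shift:
  assumes "sphere_trajectory F u"
  shows "sphere_trajectory F (\<lambda>s. u (s + c))"
proof -
  have "((\<lambda>s. u (s + c)) has_vector_derivative Fs F (u (s + c))) (at s)" for s
    using vector_diff_chain_at[of "\<lambda>s. s + c" 1 s u] sphere_trajectoryD(1)[OF assms, of "s + c"]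
      has_vector_derivative_add_const[of "\<lambda>s. s" c 1 "at s"]
    by (auto simp: o_def)
  then show ?thesis
    using sphere_trajectoryD(2)[OF assms] by (auto simp: sphere_trajectory_def ode_solution_on_def)
qed

lemma sphere_trajectory_continuous: "sphere_trajectory F u \<Longrightarrow> continuous_on UNIV u"
  by (rule continuous_on_vector_derivative, rule has_vector_derivative_at_within, rule sphere_trajectoryD(1))

lemma sphere_trajectory_dist:
  fixes F :: "real^'n \<Rightarrow> real^'n"
  assumes L: "L-lipschitz_on (sphere 0 1) F"
  obtains K where "K \<ge> 0"
    "\<And>u v s. sphere_trajectory F u \<Longrightarrow> sphere_trajectory F v \<Longrightarrow>
       norm (u s - v s) \<le> exp (K * \<bar>s\<bar>) * norm (u 0 - v 0)"
proof -
  define H where "H = (\<lambda>x. norm x *\<^sub>R Fs F (x /\<^sub>R norm x))"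
  obtain K0 where "K0-lipschitz_on (sphere 0 1) (Fs F)" using Fs_lipschitz_on_sphere[OF L] .
  then obtain K where K: "K-lipschitz_on UNIV H"
    unfolding H_def by (rule homogeneous_extension_lipschitz)
  have *: "norm (u s - v s) \<le> exp (K * \<bar>s\<bar>) * norm (u 0 - v 0)"
    if uv: "sphere_trajectory F u" "sphere_trajectory F v" for u v s
  proof -
    \<comment> \<open>The sign of \<open>s\<close> becomes the speed factor of
      \<open>gronwall_lipschitz\<close>, so forward and backward time are treated at once.\<close>
    define c where "c = (if s \<ge> 0 then 1 else - 1::real)"
    have D: "((\<lambda>s. w (c * s)) has_vector_derivative c *\<^sub>R H (w (c * r))) (at r within {0..\<bar>s\<bar>})"
      if w: "sphere_trajectory F w" for w r
    proof -
      have "((\<lambda>s. c * s) has_vector_derivative c) (at r)"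
        using has_vector_derivative_mult_right[OF has_vector_derivative_id, of c "at r"] by simp
      moreover have "(w has_vector_derivative H (w (c * r))) (at (c * r))"
        using sphere_trajectoryD[OF w, of "c * r"] by (simp add: H_def)
      ultimately show ?thesis
        using vector_diff_chain_at[of "\<lambda>s. c * s" c r w] by (auto simp: o_def intro: has_vector_derivative_at_within)
    qed
    have "norm (u (c * \<bar>s\<bar>) - v (c * \<bar>s\<bar>)) \<le> exp (K * 1 * (\<bar>s\<bar> - 0)) * norm (u (c * 0) - v (c * 0))"
      by (rule gronwall_lipschitz[OF K, where c = "\<lambda>_. c"]) (use D uv in \<open>auto simp: c_def\<close>)
    then show ?thesis by (auto simp: c_def split: if_splits)
  qed
  show thesis by (rule that[OF lipschitz_on_nonneg[OF K] *])
qed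

section \<open>Lyapunov stability of a fixed-point attractor\<close>

lemma first_hitting_time:
  fixes g :: "real \<Rightarrow> real"
  assumes g: "continuous_on {a..b} g" and "a \<le> b" "g a \<le> c" "c \<le> g b"
  obtains s where "a \<le> s" "s \<le> b" "g s = c" "\<And>r. a \<le> r \<Longrightarrow> r \<le> s \<Longrightarrow> g r \<le> c"
proof -
  \<comment> \<open>The times at or above the level form a compact set and so have a least element;
    by the intermediate value theorem the level \<open>c\<close> is attained no later, hence exactly
    there.\<close>
  let ?A = "{s \<in> {a..b}. c \<le> g s}"
  have "closed ({a..b} \<inter> g -` {c..})"
    by (rule continuous_closed_preimage[OF g closed_real_atLeastAtMost closed_atLeast])
  also have "{a..b} \<inter> g -` {c..} = ?A" by auto
  finally have "closed ?A" .
  moreover have "bounded ?A" by (rule bounded_subset[OF bounded_closed_interval[of a b]]) auto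
  ultimately have "compact ?A" by (simp only: compact_eq_bounded_closed)
  moreover have "?A \<noteq> {}" using assms by auto
  ultimately obtain s where s: "s \<in> ?A" "\<And>r. r \<in> ?A \<Longrightarrow> s \<le> r"
    using compact_attains_inf[of ?A] by blast
  obtain r where r: "a \<le> r" "r \<le> s" "g r = c"
    using IVT'[of g a c s] s assms continuous_on_subset[OF g, of "{a..s}"] by auto
  then have rs: "r = s" using s(2)[of r] s(1) by auto
  then have gs: "g s = c" using r by simp
  have "g r \<le> c" if "a \<le> r" "r \<le> s" for r
  proof (rule ccontr)
    assume "\<not> g r \<le> c"
    then have "r = s" using s that by (intro antisym) auto
    with \<open>\<not> g r \<le> c\<close> gs show False by simp
  qed
  then show thesis using that[of s] gs s by auto
qed

text \<open>Orbits that leave a small ball around \<open>p\<close> after starting ever closer to \<open>p\<close> take ever longer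
  to do so; a limit of their exit points has its whole backward orbit in the ball, which the
  attractor condition only allows for \<open>p\<close> itself.\<close>

lemma point_attractor_stable:
  fixes F :: "real^'n \<Rightarrow> real^'n"
  assumes L: "L-lipschitz_on (sphere 0 1) F" and att: "attractor F {p}"
    and p0: "Fs F p = 0" and \<epsilon>: "\<epsilon> > 0"
  obtains \<delta> where "\<delta> > 0"
    "\<And>u s. sphere_trajectory F u \<Longrightarrow> dist (u 0) p < \<delta> \<Longrightarrow> 0 \<le> s \<Longrightarrow> dist (u s) p < \<epsilon>"
proof (rule ccontr)
  assume neg: "\<not> thesis"
  obtain U0 V where p: "p \<in> sphere 0 1" and V: "openin (top_of_set (sphere 0 1)) V" "p \<in> V" "V \<subseteq> U0"
    and U0: "(\<Inter>s\<in>{0..}. flow_image F s U0) = {p}"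
    using att unfolding attractor_def by auto
  obtain e where e: "e > 0" "e \<le> \<epsilon>" "\<And>y. y \<in> sphere 0 1 \<Longrightarrow> dist y p \<le> e \<Longrightarrow> y \<in> V"
  proof -
    obtain e0 where e0: "e0 > 0" "cball p e0 \<inter> sphere 0 1 \<subseteq> V"
      using V openin_contains_cball[of "sphere 0 1" V] by blast
    show thesis
      by (rule that[of "min e0 \<epsilon>"]) (use e0 \<epsilon> in \<open>auto simp: dist_commute\<close>)
  qed
  obtain K where K: "K \<ge> 0" "\<And>u v s. sphere_trajectory F u \<Longrightarrow> sphere_trajectory F v \<Longrightarrow>
       norm (u s - v s) \<le> exp (K * \<bar>s\<bar>) * norm (u 0 - v 0)"
    using sphere_trajectory_dist[OF L] by blast
  have constp: "sphere_trajectory F (\<lambda>_. p)"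
    using p p0 by (auto simp: sphere_trajectory_def ode_solution_on_def)
  have "\<exists>u s. sphere_trajectory F u \<and> real n \<le> s \<and> dist (u s) p = e \<and>
      (\<forall>r. 0 \<le> r \<longrightarrow> r \<le> s \<longrightarrow> dist (u r) p \<le> e)" for n
  proof -
    \<comment> \<open>The distance to the constant trajectory \<open>p\<close> grows at most by the
      factor \<open>exp (K * s)\<close>, so an orbit that starts within
      \<open>e * exp (- K * n)\<close> needs at least time \<open>n\<close> to reach distance
      \<open>e\<close>.\<close>
    have "e * exp (- K * n) > 0" using e by simp
    with neg that obtain u s where us: "sphere_trajectory F u" "dist (u 0) p < e * exp (- K * n)"
      "0 \<le> s" "\<not> dist (u s) p < \<epsilon>" by blast
    have c1: "continuous_on {0..s} (\<lambda>s. dist (u s) p)"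
      by (intro continuous_intros continuous_on_subset[OF sphere_trajectory_continuous[OF us(1)]]) auto
    have c2: "dist (u 0) p \<le> e"
    proof -
      have "exp (- K * n) \<le> 1" using K(1) by simp
      then have "e * exp (- K * n) \<le> e" using e(1) by (intro mult_left_le) auto
      then show ?thesis using us(2) by simp
    qed
    have c3: "e \<le> dist (u s) p" using us(4) e by simp
    obtain s' where s': "0 \<le> s'" "s' \<le> s" "dist (u s') p = e"
      "\<And>r. 0 \<le> r \<Longrightarrow> r \<le> s' \<Longrightarrow> dist (u r) p \<le> e"
      by (rule first_hitting_time[OF c1 us(3) c2 c3]) blast
    have "e \<le> exp (K * s') * dist (u 0) p"
      using K(2)[OF us(1) constp, of s'] s' by (simp add: dist_norm)
    also have "\<dots> < exp (K * s') * (e * exp (- K * n))"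
      using us(2) by simp
    also have "\<dots> = e * exp (K * (s' - n))" by (simp add: right_diff_distrib exp_diff exp_minus divide_inverse)
    finally have "0 < K * (s' - n)" using e by simp
    then have "real n \<le> s'" using K(1) by (simp add: zero_less_mult_iff)
    then show ?thesis using us(1) s' by blast
  qed
  then obtain u s where us: "\<And>n. sphere_trajectory F (u n)" "\<And>n. real n \<le> s n" "\<And>n. dist (u n (s n)) p = e"
    "\<And>n r. 0 \<le> r \<Longrightarrow> r \<le> s n \<Longrightarrow> dist (u n r) p \<le> e"
    by metis
  have "\<forall>n. u n (s n) \<in> sphere 0 1" using sphere_trajectoryD(2)[OF us(1)] by blast
  then obtain q r where q: "q \<in> sphere 0 1" and r: "strict_mono r"
    and "((\<lambda>n. u n (s n)) \<circ> r) \<longlonglongrightarrow> q"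
    by (rule seq_compactE[OF compact_imp_seq_compact[OF compact_sphere]])
  then have lim: "(\<lambda>n. u (r n) (s (r n))) \<longlonglongrightarrow> q" by (simp add: o_def)
  have "(\<lambda>n. dist (u (r n) (s (r n))) p) \<longlonglongrightarrow> dist q p" by (intro tendsto_intros lim)
  then have qe: "dist q p = e" using LIMSEQ_unique[of "\<lambda>_. e"] us(3) by simp
  obtain v where v: "sphere_trajectory F v" "v 0 = q" using sphere_trajectory_exists[OF L q] .
  \<comment> \<open>The points at time \<open>\<sigma>\<close> before the exit converge to
    \<open>v (- \<sigma>)\<close>. From some index on these times are nonnegative, so the limit lies
    in the closed ball of radius \<open>e\<close>, hence in \<open>U0\<close>, and flows to
    \<open>q\<close> in time \<open>\<sigma>\<close>.\<close>
  have "q \<in> flow_image F \<sigma> U0" if \<sigma>: "0 \<le> \<sigma>" for \<sigma>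
  proof -
    have b: "norm (u (r n) (s (r n) - \<sigma>) - v (- \<sigma>)) \<le> exp (K * \<sigma>) * norm (u (r n) (s (r n)) - q)" for n
      using K(2)[OF sphere_trajectory_shift[OF us(1), of "r n" "s (r n)"] v(1), of "- \<sigma>"] \<sigma> v(2) by simp
    have "(\<lambda>n. exp (K * \<sigma>) * norm (u (r n) (s (r n)) - q)) \<longlonglongrightarrow> 0"
      using tendsto_mult_right_zero[OF tendsto_norm_zero[OF Lim_null[THEN iffD1, OF lim]]] .
    then have "(\<lambda>n. u (r n) (s (r n) - \<sigma>) - v (- \<sigma>)) \<longlonglongrightarrow> 0"
      by (rule Lim_null_comparison[rotated]) (intro always_eventually allI b)
    then have "(\<lambda>n. u (r n) (s (r n) - \<sigma>)) \<longlonglongrightarrow> v (- \<sigma>)" by (rule LIM_zero_cancel)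
    then have "(\<lambda>n. dist (u (r n) (s (r n) - \<sigma>)) p) \<longlonglongrightarrow> dist (v (- \<sigma>)) p" by (intro tendsto_intros)
    moreover have "\<forall>n\<ge>nat \<lceil>\<sigma>\<rceil>. dist (u (r n) (s (r n) - \<sigma>)) p \<le> e"
    proof (intro allI impI us(4))
      fix n assume "n \<ge> nat \<lceil>\<sigma>\<rceil>"
      then have "\<sigma> \<le> real n" by linarith
      also have "\<dots> \<le> s (r n)" using us(2)[of "r n"] seq_suble[OF r, of n] by linarith
      finally show "0 \<le> s (r n) - \<sigma>" by simp
    qed (use \<sigma> in simp)
    ultimately have "dist (v (- \<sigma>)) p \<le> e" by (blast intro: LIMSEQ_le_const2)
    then have "v (- \<sigma>) \<in> U0" using e(3) sphere_trajectoryD(2)[OF v(1)] V(3) by blast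
    then show ?thesis
      unfolding flow_image_def using sphere_trajectory_shift[OF v(1), of "- \<sigma>"] v(2)
      by (intro CollectI exI[of _ "\<lambda>s. v (s + - \<sigma>)"]) simp
  qed
  then have "q = p" using U0 by blast
  then show False using qe e by simp
qed

section \<open>Polar coordinates\<close>

lemma has_real_derivative_halfline_at:
  assumes "(g has_real_derivative d) (at s within {0..})" "0 < s"
  shows "(g has_real_derivative d) (at s)"
  using assms at_within_interior[of s "{0..}"] by (simp add: interior_Ici[of "-1"])

lemma decreasing_halfline:
  fixes g :: "real \<Rightarrow> real"
  assumes der: "\<And>s. 0 \<le> s \<Longrightarrow> (g has_real_derivative g' s) (at s within {0..})"
    and "0 \<le> a" "a \<le> b" and le: "\<And>s. a \<le> s \<Longrightarrow> s \<le> b \<Longrightarrow> g' s \<le> 0"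
  shows "g b \<le> g a"
proof (rule DERIV_nonpos_imp_decreasing_open[OF \<open>a \<le> b\<close>])
  show "continuous_on {a..b} g"
    using der \<open>0 \<le> a\<close> by (intro continuous_on_subset[OF DERIV_continuous_on[of "{0..}" g g']]) auto
  show "\<exists>y. (g has_real_derivative y) (at s) \<and> y \<le> 0" if "a < s" "s < b" for s
    using der[of s] le[of s] that \<open>0 \<le> a\<close> by (intro exI[of _ "g' s"]) (auto intro: has_real_derivative_halfline_at)
qed

text \<open>In the time \<open>s\<close> of the trajectory \<open>u\<close>, the point \<open>polar_radius F r1 u s *\<^sub>R u s\<close> is the
  singular solution from \<open>r1 *\<^sub>R u 0\<close> at the physical time \<open>polar_time \<alpha> F r1 t1 u s\<close>.\<close>

definition polar_radius :: "(real^'n \<Rightarrow> real^'n) \<Rightarrow> real \<Rightarrow> (real \<Rightarrow> real^'n) \<Rightarrow> real \<Rightarrow> real" where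
  "polar_radius F r1 u s = r1 * exp (integral {0..s} (\<lambda>\<sigma>. Fr F (u \<sigma>)))"

definition polar_time :: "real \<Rightarrow> (real^'n \<Rightarrow> real^'n) \<Rightarrow> real \<Rightarrow> real \<Rightarrow> (real \<Rightarrow> real^'n) \<Rightarrow> real \<Rightarrow> real" where
  "polar_time \<alpha> F r1 t1 u s = t1 + integral {0..s} (\<lambda>\<sigma>. polar_radius F r1 u \<sigma> powr (1 - \<alpha>))"

lemma polar_radius_pos: "r1 > 0 \<Longrightarrow> polar_radius F r1 u s > 0"
  by (simp add: polar_radius_def)

lemma polar_0 [simp]: "polar_radius F r1 u 0 = r1" "polar_time \<alpha> F r1 t1 u 0 = t1"
  by (simp_all add: polar_radius_def polar_time_def)

context
  fixes F :: "real^'n \<Rightarrow> real^'n" and L r1 :: real and u :: "real \<Rightarrow> real^'n"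
  assumes lip: "L-lipschitz_on (sphere 0 1) F" and traj: "sphere_trajectory F u" and r1: "r1 > 0"
begin

lemma polar_radius_deriv:
  assumes "0 \<le> s"
  shows "(polar_radius F r1 u has_real_derivative polar_radius F r1 u s * Fr F (u s)) (at s within {0..})"
proof -
  have "continuous_on {0..} (\<lambda>\<sigma>. Fr F (u \<sigma>))"
    by (rule continuous_on_compose2[OF Fr_continuous_on_sphere[OF lip]
          continuous_on_subset[OF sphere_trajectory_continuous[OF traj]]])
       (use sphere_trajectoryD(2)[OF traj] in blast)+
  from integral_has_vector_derivative_halfline[OF this assms]
  have "((\<lambda>s. integral {0..s} (\<lambda>\<sigma>. Fr F (u \<sigma>))) has_real_derivative Fr F (u s)) (at s within {0..})"
    by (simp add: has_real_derivative_iff_has_vector_derivative)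
  then show ?thesis
    unfolding polar_radius_def by (auto intro!: derivative_eq_intros)
qed

lemma polar_radius_continuous: "continuous_on {0..} (polar_radius F r1 u)"
  by (rule DERIV_continuous_on) (auto intro: polar_radius_deriv)

lemma polar_radius_powr_deriv:
  assumes "0 \<le> s"
  shows "((\<lambda>s. polar_radius F r1 u s powr (1 - \<alpha>)) has_real_derivative
    (1 - \<alpha>) * Fr F (u s) * polar_radius F r1 u s powr (1 - \<alpha>)) (at s within {0..})"
proof -
  have "polar_radius F r1 u s powr (- \<alpha>) * polar_radius F r1 u s = polar_radius F r1 u s powr (1 - \<alpha>)"
    using powr_mult_base[of "polar_radius F r1 u s" "- \<alpha>"] polar_radius_pos[OF r1, of F u s]
    by (simp add: mult.commute)
  then have eq: "(1 - \<alpha>) * polar_radius F r1 u s powr (1 - \<alpha> - 1) * (polar_radius F r1 u s * Fr F (u s))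
      = (1 - \<alpha>) * Fr F (u s) * polar_radius F r1 u s powr (1 - \<alpha>)"
    by (simp add: ac_simps)
  show ?thesis
    using DERIV_chain2[OF has_real_derivative_powr[OF polar_radius_pos[OF r1]] polar_radius_deriv[OF assms]]
    by (rule DERIV_cong[OF _ eq])
qed

lemma polar_time_deriv:
  assumes "0 \<le> s"
  shows "(polar_time \<alpha> F r1 t1 u has_real_derivative polar_radius F r1 u s powr (1 - \<alpha>)) (at s within {0..})"
proof -
  have "continuous_on {0..} (\<lambda>s. polar_radius F r1 u s powr (1 - \<alpha>))"
    by (rule DERIV_continuous_on) (auto intro: polar_radius_powr_deriv)
  from integral_has_vector_derivative_halfline[OF this assms]
  show ?thesis
    unfolding polar_time_def has_real_derivative_iff_has_vector_derivative
    by (auto intro!: derivative_eq_intros)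
qed

lemma polar_time_continuous: "continuous_on {0..} (polar_time \<alpha> F r1 t1 u)"
  by (rule DERIV_continuous_on) (auto intro: polar_time_deriv)

lemma polar_time_strict_mono:
  assumes "0 \<le> a" "a < b"
  shows "polar_time \<alpha> F r1 t1 u a < polar_time \<alpha> F r1 t1 u b"
proof (rule DERIV_pos_imp_increasing_open[OF \<open>a < b\<close>])
  show "continuous_on {a..b} (polar_time \<alpha> F r1 t1 u)"
    using assms by (intro continuous_on_subset[OF polar_time_continuous]) auto
  show "\<exists>y. (polar_time \<alpha> F r1 t1 u has_real_derivative y) (at s) \<and> y > 0" if "a < s" "s < b" for s
    using that assms polar_radius_pos[OF r1, of F u s]
    by (intro exI[of _ "polar_radius F r1 u s powr (1 - \<alpha>)"] conjI
        has_real_derivative_halfline_at[OF polar_time_deriv]) auto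
qed

lemma polar_time_mono:
  "0 \<le> a \<Longrightarrow> a \<le> b \<Longrightarrow> polar_time \<alpha> F r1 t1 u a \<le> polar_time \<alpha> F r1 t1 u b"
  using polar_time_strict_mono[of a b \<alpha> t1] by (cases "a = b") auto

text \<open>In the time \<open>s\<close> both \<open>x\<close> after \<open>polar_time\<close> and
  the polar curve solve the regularized equation multiplied by
  \<open>polar_radius powr (1 - \<alpha>)\<close>, so Gronwall makes them equal. The lower bound on
  the radius is needed along the polar curve alone, where it turns the regularized field into the
  singular one.\<close>

lemma polar_solution:
  assumes \<alpha>: "\<alpha> < 1" and reg: "regularization \<alpha> F G" and \<nu>: "\<nu> > 0" and S: "0 \<le> S"
    and x: "\<And>t. t \<in> {t1..polar_time \<alpha> F r1 t1 u S} \<Longrightarrow>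
      (x has_vector_derivative reg_field \<alpha> F G \<nu> (x t)) (at t within {t1..polar_time \<alpha> F r1 t1 u S})"
    and x1: "x t1 = r1 *\<^sub>R u 0"
    and r: "\<And>s. 0 \<le> s \<Longrightarrow> s \<le> S \<Longrightarrow> \<nu> \<le> polar_radius F r1 u s"
  shows "x (polar_time \<alpha> F r1 t1 u S) = polar_radius F r1 u S *\<^sub>R u S"
proof -
  let ?r = "polar_radius F r1 u" and ?t = "polar_time \<alpha> F r1 t1 u"
  obtain K where K: "K-lipschitz_on UNIV (reg_field \<alpha> F G \<nu>)" using reg_field_lipschitz[OF \<alpha> reg \<nu>] .
  define c where "c = (\<lambda>s. ?r s powr (1 - \<alpha>))"
  have "continuous_on {0..S} c"
    unfolding c_def
    by (rule continuous_on_subset[OF DERIV_continuous_on[OF polar_radius_powr_deriv]]) auto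
  then have "bounded (c ` {0..S})"
    by (intro compact_imp_bounded compact_continuous_image) auto
  then obtain C where "\<forall>y\<in>c ` {0..S}. norm y \<le> C"
    unfolding bounded_iff by blast
  then have C: "\<And>s. s \<in> {0..S} \<Longrightarrow> \<bar>c s\<bar> \<le> C" by auto
  have "norm (x (?t S) - ?r S *\<^sub>R u S) \<le> exp (K * C * (S - 0)) * norm (x (?t 0) - ?r 0 *\<^sub>R u 0)"
  proof (rule gronwall_lipschitz[OF K S])
    fix s assume s: "s \<in> {0..S}"
    have "?t ` {0..S} \<subseteq> {t1..?t S}"
      using polar_time_mono[of 0 _ \<alpha> t1] polar_time_mono[of _ S \<alpha> t1] by auto
    moreover have "(?t has_vector_derivative c s) (at s within {0..S})"
      using polar_time_deriv[of s \<alpha> t1] s unfolding c_def has_real_derivative_iff_has_vector_derivative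
      by (auto intro: has_vector_derivative_within_subset)
    moreover have "?t s \<in> {t1..?t S}" using calculation(1) s by blast
    ultimately show "((\<lambda>s. x (?t s)) has_vector_derivative c s *\<^sub>R reg_field \<alpha> F G \<nu> (x (?t s))) (at s within {0..S})"
      using vector_diff_chain_within[of ?t "c s" s "{0..S}" x "reg_field \<alpha> F G \<nu> (x (?t s))"]
        has_vector_derivative_within_subset[OF x] by (auto simp: o_def)
    have rs: "?r s > 0" by (rule polar_radius_pos[OF r1])
    have us: "norm (u s) = 1" using sphere_trajectoryD(2)[OF traj, of s] by simp
    have "reg_field \<alpha> F G \<nu> (?r s *\<^sub>R u s) = singular_field \<alpha> F (?r s *\<^sub>R u s)"
      using r[of s] s us rs by (intro reg_field_eq_singular_field[OF reg \<nu>]) auto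
    also have "\<dots> = (?r s powr \<alpha>) *\<^sub>R F (u s)" using us rs by (simp add: singular_field_def)
    finally have "c s *\<^sub>R reg_field \<alpha> F G \<nu> (?r s *\<^sub>R u s) = ?r s *\<^sub>R F (u s)"
      using rs by (simp add: c_def flip: powr_add)
    moreover have "((\<lambda>s. ?r s *\<^sub>R u s) has_vector_derivative ?r s *\<^sub>R Fs F (u s) + (?r s * Fr F (u s)) *\<^sub>R u s) (at s within {0..S})"
      using s by (intro has_vector_derivative_scaleR has_vector_derivative_at_within[OF sphere_trajectoryD(1)[OF traj]]
          DERIV_subset[OF polar_radius_deriv]) auto
    ultimately show "((\<lambda>s. ?r s *\<^sub>R u s) has_vector_derivative c s *\<^sub>R reg_field \<alpha> F G \<nu> (?r s *\<^sub>R u s)) (at s within {0..S})"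
      by (simp add: Fs_def algebra_simps)
  qed (use C in auto)
  then show ?thesis using x1 by simp
qed

text \<open>Once the direction is close to \<open>p\<close>, \<open>Fr\<close> stays below half of
  its negative limit, so the radius decays exponentially in \<open>s\<close>. The physical time is
  increasing and bounded, hence convergent.\<close>

lemma polar_collapse:
  assumes \<alpha>: "\<alpha> < 1" and up: "(u \<longlongrightarrow> p) at_top" and p: "Fr F p < 0"
  obtains T where "(polar_radius F r1 u \<longlongrightarrow> 0) at_top" "(polar_time \<alpha> F r1 t1 u \<longlongrightarrow> T) at_top"
    "\<And>s. 0 \<le> s \<Longrightarrow> polar_time \<alpha> F r1 t1 u s \<le> T"
proof -
  let ?r = "polar_radius F r1 u" and ?t = "polar_time \<alpha> F r1 t1 u"
  define k where "k = - Fr F p / 2"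
  have k: "k > 0" using p by (simp add: k_def)
  have uS: "u s \<in> sphere 0 1" for s by (rule sphere_trajectoryD(2)[OF traj])
  then have "p \<in> sphere 0 1"
    by (intro Lim_in_closed_set[OF closed_sphere _ _ up]) auto
  then have "((\<lambda>s. Fr F (u s)) \<longlongrightarrow> Fr F p) at_top"
    by (intro continuous_on_tendsto_compose[OF Fr_continuous_on_sphere[OF lip] up]) (use uS in auto)
  then have "\<forall>\<^sub>F s in at_top. Fr F (u s) < - k"
    by (rule order_tendstoD) (use k in \<open>simp add: k_def\<close>)
  then obtain s0' where s0': "\<And>s. s \<ge> s0' \<Longrightarrow> Fr F (u s) < - k"
    by (auto simp: eventually_at_top_linorder)
  define s0 where "s0 = max 0 s0'"
  have s0: "s0 \<ge> 0" "\<And>s. s \<ge> s0 \<Longrightarrow> Fr F (u s) \<le> - k"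
    using s0' by (auto simp: s0_def intro: less_imp_le)
  have rpos: "?r s > 0" for s by (rule polar_radius_pos[OF r1])
  have rle: "?r s \<le> ?r s0 * exp (- k * (s - s0))" if "s \<ge> s0" for s
  proof -
    have "?r s * exp (k * (s - s0)) \<le> ?r s0 * exp (k * (s0 - s0))"
    proof (rule decreasing_halfline[OF _ s0(1) that])
      show "((\<lambda>s. ?r s * exp (k * (s - s0))) has_real_derivative
          ?r s * exp (k * (s - s0)) * (Fr F (u s) + k)) (at s within {0..})" if "0 \<le> s" for s
        using polar_radius_deriv[OF that] by (auto intro!: derivative_eq_intros simp: algebra_simps)
      show "?r s * exp (k * (s - s0)) * (Fr F (u s) + k) \<le> 0" if "s0 \<le> s" for s
        using s0(2)[OF that] rpos[of s] by (intro mult_nonneg_nonpos) (auto intro: less_imp_le)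
    qed
    then have "?r s * exp (k * (s - s0)) * exp (- k * (s - s0)) \<le> ?r s0 * exp (- k * (s - s0))"
      by (intro mult_right_mono) auto
    then show ?thesis by (simp add: mult.assoc flip: exp_add)
  qed
  have "((\<lambda>s. ?r s0 * exp (- k * (s - s0))) \<longlongrightarrow> 0) at_top"
  proof (intro tendsto_mult_right_zero filterlim_compose[OF exp_at_bot] filterlim_tendsto_neg_mult_at_bot[OF tendsto_const])
    have "\<forall>\<^sub>F s in at_top. Z \<le> s - s0" for Z :: real
      by (rule eventually_at_top_linorderI[of "Z + s0"]) simp
    then show "filterlim (\<lambda>s. s - s0) at_top at_top" by (simp add: filterlim_at_top)
  qed (use k in simp)
  then have r0: "(?r \<longlongrightarrow> 0) at_top"
    by (rule tendsto_sandwich[rotated 3, where f = "\<lambda>_. 0"])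
       (use rpos rle in \<open>auto simp: less_imp_le intro!: eventually_at_top_linorderI[of s0]\<close>)
  \<comment> \<open>After \<open>s0\<close> the quantity \<open>?r powr (1 - \<alpha>)\<close> loses
    at least \<open>(1 - \<alpha>) * k\<close> times the elapsed physical time, so \<open>h\<close>
    is nonincreasing there and bounds the physical time.\<close>
  define h where "h = (\<lambda>s. ?t s + ?r s powr (1 - \<alpha>) / ((1 - \<alpha>) * k))"
  have "?t s \<le> h s0" if "s \<ge> 0" for s
  proof -
    have "?t s \<le> ?t (max s s0)" using that by (intro polar_time_mono) auto
    also have "\<dots> \<le> h (max s s0)" using k \<alpha> by (simp add: h_def)
    also have "\<dots> \<le> h s0"
    proof (rule decreasing_halfline[OF _ s0(1)])
      show "(h has_real_derivative ?r s powr (1 - \<alpha>) + ((1 - \<alpha>) * Fr F (u s) * ?r s powr (1 - \<alpha>)) / ((1 - \<alpha>) * k))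
          (at s within {0..})" if "0 \<le> s" for s
        unfolding h_def
        by (intro DERIV_add polar_time_deriv DERIV_cdivide polar_radius_powr_deriv that)
      show "?r s powr (1 - \<alpha>) + ((1 - \<alpha>) * Fr F (u s) * ?r s powr (1 - \<alpha>)) / ((1 - \<alpha>) * k) \<le> 0" if "s0 \<le> s" for s
      proof -
        have "?r s powr (1 - \<alpha>) + ((1 - \<alpha>) * Fr F (u s) * ?r s powr (1 - \<alpha>)) / ((1 - \<alpha>) * k)
           = ?r s powr (1 - \<alpha>) * ((k + Fr F (u s)) / k)"
          using k \<alpha> by (simp add: field_simps)
        also have "\<dots> \<le> 0"
          using s0(2)[OF that] k by (intro mult_nonneg_nonpos divide_nonpos_pos) auto
        finally show ?thesis .
      qed
    qed auto
    finally show ?thesis .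
  qed
  then have bdd: "bdd_above (?t ` {0..})" by (intro bdd_aboveI[of _ "h s0"]) auto
  define T where "T = Sup (?t ` {0..})"
  have le: "?t s \<le> T" if "0 \<le> s" for s
    unfolding T_def using bdd that by (intro cSup_upper) auto
  have "(?t \<longlongrightarrow> T) at_top"
  proof (rule increasing_tendsto)
    show "\<forall>\<^sub>F s in at_top. ?t s \<le> T" using le by (intro eventually_at_top_linorderI[of 0])
    fix y assume "y < T"
    then obtain s1 where "s1 \<ge> 0" "y < ?t s1"
      unfolding T_def using bdd by (subst (asm) less_cSup_iff) auto
    then show "\<forall>\<^sub>F s in at_top. y < ?t s"
      by (intro eventually_at_top_linorderI[of s1]) (use polar_time_mono[of s1 _ \<alpha> t1] in fastforce)
  qed
  with r0 le show thesis using that by blast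
qed

text \<open>Along the whole orbit \<open>Fr\<close> is at least \<open>a - \<eta> > 0\<close>. The
  last estimate integrates \<open>d(r powr (1 - \<alpha>))/dt = (1 - \<alpha>) * Fr\<close>, with
  \<open>t\<close> the physical time.\<close>

lemma polar_expand:
  assumes \<alpha>: "\<alpha> < 1" and \<eta>: "\<eta> < a" and near: "\<And>s. 0 \<le> s \<Longrightarrow> \<bar>Fr F (u s) - a\<bar> \<le> \<eta>"
  shows polar_expand_radius: "\<And>s. 0 \<le> s \<Longrightarrow> r1 \<le> polar_radius F r1 u s"
    and polar_expand_time: "\<And>t. t1 \<le> t \<Longrightarrow> \<exists>s\<ge>0. polar_time \<alpha> F r1 t1 u s = t"
    and polar_expand_radius_time: "\<And>s. 0 \<le> s \<Longrightarrow>
      \<bar>polar_radius F r1 u s powr (1 - \<alpha>) - r1 powr (1 - \<alpha>) - (1 - \<alpha>) * a * (polar_time \<alpha> F r1 t1 u s - t1)\<bar>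
        \<le> (1 - \<alpha>) * \<eta> * (polar_time \<alpha> F r1 t1 u s - t1)"
proof -
  let ?r = "polar_radius F r1 u" and ?t = "polar_time \<alpha> F r1 t1 u"
  have rpos: "?r s > 0" for s by (rule polar_radius_pos[OF r1])
  show r: "r1 \<le> ?r s" if "0 \<le> s" for s
  proof -
    have "- ?r s \<le> - ?r 0"
    proof (rule decreasing_halfline[OF _ order_refl that])
      show "((\<lambda>s. - ?r s) has_real_derivative - (?r s * Fr F (u s))) (at s within {0..})" if "0 \<le> s" for s
        by (intro DERIV_minus polar_radius_deriv that)
      show "- (?r s * Fr F (u s)) \<le> 0" if "0 \<le> s" for s
        using near[OF that] \<eta> rpos[of s] by (auto simp: zero_le_mult_iff)
    qed
    then show ?thesis by simp
  qed
  show "\<exists>s\<ge>0. ?t s = t" if "t1 \<le> t" for t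
  proof -
    \<comment> \<open>Since the radius never drops below \<open>r1\<close>, the physical time
      advances at rate at least \<open>r1 powr (1 - \<alpha>)\<close> and has reached
      \<open>t\<close> by \<open>s = S\<close>.\<close>
    define S where "S = (t - t1) / r1 powr (1 - \<alpha>)"
    have S: "S \<ge> 0" using that by (simp add: S_def)
    have "S * r1 powr (1 - \<alpha>) - ?t S \<le> 0 * r1 powr (1 - \<alpha>) - ?t 0"
    proof (rule decreasing_halfline[OF _ order_refl S])
      show "((\<lambda>s. s * r1 powr (1 - \<alpha>) - ?t s) has_real_derivative r1 powr (1 - \<alpha>) - ?r s powr (1 - \<alpha>)) (at s within {0..})"
        if "0 \<le> s" for s
        using polar_time_deriv[OF that, of \<alpha> t1] by (auto intro!: derivative_eq_intros)
      show "r1 powr (1 - \<alpha>) - ?r s powr (1 - \<alpha>) \<le> 0" if "0 \<le> s" for s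
        using r[OF that] r1 \<alpha> by (simp add: powr_mono2)
    qed
    then have "t \<le> ?t S" using r1 by (simp add: S_def)
    moreover have "continuous_on {0..S} ?t" by (rule continuous_on_subset[OF polar_time_continuous]) auto
    ultimately show ?thesis using IVT'[of ?t 0 t S] that S by auto
  qed
  show "\<bar>?r s powr (1 - \<alpha>) - r1 powr (1 - \<alpha>) - (1 - \<alpha>) * a * (?t s - t1)\<bar> \<le> (1 - \<alpha>) * \<eta> * (?t s - t1)"
    if s: "0 \<le> s" for s
  proof -
    \<comment> \<open>The case \<open>\<kappa> = 1\<close> gives the upper half and
      \<open>\<kappa> = - 1\<close> the lower half of the bound on the absolute value.\<close>
    have est: "\<kappa> * ?r s powr (1 - \<alpha>) - \<beta> * ?t s \<le> \<kappa> * ?r 0 powr (1 - \<alpha>) - \<beta> * ?t 0"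
      if "\<And>s. 0 \<le> s \<Longrightarrow> \<kappa> * (1 - \<alpha>) * Fr F (u s) \<le> \<beta>" for \<kappa> \<beta>
    proof (rule decreasing_halfline[OF _ order_refl s])
      show "((\<lambda>s. \<kappa> * ?r s powr (1 - \<alpha>) - \<beta> * ?t s) has_real_derivative
          (\<kappa> * ((1 - \<alpha>) * Fr F (u s) * ?r s powr (1 - \<alpha>)) - \<beta> * ?r s powr (1 - \<alpha>))) (at s within {0..})" if "0 \<le> s" for s
        by (intro DERIV_diff DERIV_cmult polar_time_deriv polar_radius_powr_deriv that)
      show "\<kappa> * ((1 - \<alpha>) * Fr F (u s) * ?r s powr (1 - \<alpha>)) - \<beta> * ?r s powr (1 - \<alpha>) \<le> 0" if "0 \<le> s" for s
        using mult_right_mono[OF \<open>0 \<le> s \<Longrightarrow> \<kappa> * (1 - \<alpha>) * Fr F (u s) \<le> \<beta>\<close>[OF that], of "?r s powr (1 - \<alpha>)"]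
        by (simp add: mult.assoc)
    qed
    have 1: "1 * (1 - \<alpha>) * Fr F (u s) \<le> (1 - \<alpha>) * (a + \<eta>)" if "0 \<le> s" for s
      using near[OF that] \<alpha> by (simp add: abs_le_iff)
    have 2: "(- 1) * (1 - \<alpha>) * Fr F (u s) \<le> - ((1 - \<alpha>) * (a - \<eta>))" if "0 \<le> s" for s
    proof -
      have "(1 - \<alpha>) * (a - \<eta>) \<le> (1 - \<alpha>) * Fr F (u s)"
        using near[OF that] \<alpha> by (intro mult_left_mono) (auto simp: abs_le_iff)
      then show ?thesis by (simp add: algebra_simps)
    qed
    show ?thesis
      using est[of 1, OF 1] est[of "- 1", OF 2] by (simp add: abs_le_iff algebra_simps)
  qed
qed

end

section \<open>Collapse and expulsion\<close>

text \<open>With the time unit \<open>\<nu> powr (1 - \<alpha>)\<close> the factor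
  \<open>\<nu> powr \<alpha>\<close> of \<open>reg_field_scale\<close> cancels against the division
  by \<open>\<nu>\<close>. The shifts \<open>c\<close> and \<open>\<tau>0\<close> allow the physical
  entry time to be matched with the rescaled one.\<close>

lemma rescaled_solution:
  assumes \<nu>: "\<nu> > 0" and x: "ode_solution_on (reg_field \<alpha> F G \<nu>) UNIV x"
  shows "ode_solution_on (reg_field \<alpha> F G 1) UNIV (\<lambda>\<tau>. x (c + \<nu> powr (1 - \<alpha>) * (\<tau> - \<tau>0)) /\<^sub>R \<nu>)"
  unfolding ode_solution_on_def
proof
  fix \<tau> :: real
  let ?k = "\<nu> powr (1 - \<alpha>)" and ?t = "c + \<nu> powr (1 - \<alpha>) * (\<tau> - \<tau>0)"
  have "((\<lambda>\<tau>. c + ?k * (\<tau> - \<tau>0)) has_vector_derivative ?k) (at \<tau>)"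
    by (auto simp flip: has_real_derivative_iff_has_vector_derivative intro!: derivative_eq_intros)
  moreover have "(x has_vector_derivative reg_field \<alpha> F G \<nu> (x ?t)) (at ?t)"
    using x by (simp add: ode_solution_on_def)
  ultimately have "((\<lambda>\<tau>. x (c + ?k * (\<tau> - \<tau>0))) has_vector_derivative ?k *\<^sub>R reg_field \<alpha> F G \<nu> (x ?t)) (at \<tau>)"
    using vector_diff_chain_at[of "\<lambda>\<tau>. c + ?k * (\<tau> - \<tau>0)" ?k \<tau> x] by (simp add: o_def)
  then have "((\<lambda>\<tau>. x (c + ?k * (\<tau> - \<tau>0)) /\<^sub>R \<nu>) has_vector_derivative
      (?k *\<^sub>R reg_field \<alpha> F G \<nu> (x ?t)) /\<^sub>R \<nu>) (at \<tau>)"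
    by (rule bounded_linear.has_vector_derivative[OF bounded_linear_scaleR_right])
  moreover have "?k * \<nu> powr \<alpha> = \<nu>" using \<nu> by (simp flip: powr_add)
  then have "(?k *\<^sub>R reg_field \<alpha> F G \<nu> (x ?t)) /\<^sub>R \<nu> = reg_field \<alpha> F G 1 (x ?t /\<^sub>R \<nu>)"
    using \<nu> by (subst reg_field_scale[OF \<nu>]) simp
  ultimately show "((\<lambda>\<tau>. x (c + ?k * (\<tau> - \<tau>0)) /\<^sub>R \<nu>) has_vector_derivative
      reg_field \<alpha> F G 1 (x ?t /\<^sub>R \<nu>)) (at \<tau> within UNIV)"
    by simp
qed

lemma basin_pointE:
  assumes "y \<in> basin F {p}"
  obtains u where "sphere_trajectory F u" "u 0 = y" "(u \<longlongrightarrow> p) at_top"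
proof -
  obtain u where u: "sphere_trajectory F u" "u 0 = y" "((\<lambda>s. infdist (u s) {p}) \<longlongrightarrow> 0) at_top"
    using assms unfolding basin_def by blast
  from u(3) have "(u \<longlongrightarrow> p) at_top" unfolding infdist_singleton by (rule tendsto_dist_iff[THEN iffD2])
  with u show thesis using that by blast
qed

lemma reg_field_solution_unique:
  fixes F G :: "real^'n \<Rightarrow> real^'n"
  assumes \<alpha>: "\<alpha> < 1" and reg: "regularization \<alpha> F G" and \<nu>: "\<nu> > 0" and "a \<le> b"
    and x: "\<And>t. t \<in> {a..b} \<Longrightarrow> (x has_vector_derivative reg_field \<alpha> F G \<nu> (x t)) (at t within {a..b})"
    and z: "\<And>t. t \<in> {a..b} \<Longrightarrow> (z has_vector_derivative reg_field \<alpha> F G \<nu> (z t)) (at t within {a..b})"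
    and "x a = z a"
  shows "x b = z b"
proof -
  obtain L where L: "L-lipschitz_on UNIV (reg_field \<alpha> F G \<nu>)" using reg_field_lipschitz[OF \<alpha> reg \<nu>] .
  have "norm (x b - z b) \<le> exp (L * 1 * (b - a)) * norm (x a - z a)"
    by (rule gronwall_lipschitz[OF L \<open>a \<le> b\<close>, where c = "\<lambda>_. 1"]) (use x z in auto)
  then show ?thesis using \<open>x a = z a\<close> by simp
qed

section \<open>Entry into the small ball and the blowup time\<close>

context
  fixes \<alpha> L r0 t0 :: real and F G :: "real^'n \<Rightarrow> real^'n" and u :: "real \<Rightarrow> real^'n"
  assumes \<alpha>: "\<alpha> < 1" and reg: "regularization \<alpha> F G"
    and lip: "L-lipschitz_on (sphere 0 1) F" and traj: "sphere_trajectory F u" and r0: "r0 > 0"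
begin

lemma polar_entry:
  assumes lim: "(polar_radius F r0 u \<longlongrightarrow> 0) at_top" and \<nu>: "0 < \<nu>" "\<nu> < r0"
    and x: "ode_solution_on (reg_field \<alpha> F G \<nu>) UNIV x" "x t0 = r0 *\<^sub>R u 0"
  obtains s where "0 \<le> s" "polar_radius F r0 u s = \<nu>" "x (polar_time \<alpha> F r0 t0 u s) = \<nu> *\<^sub>R u s"
proof -
  have "\<forall>\<^sub>F s in at_top. polar_radius F r0 u s < \<nu> \<and> 0 \<le> s"
    using order_tendstoD(2)[OF lim \<nu>(1)] eventually_ge_at_top[of 0] by (rule eventually_conj)
  then obtain S where S: "polar_radius F r0 u S < \<nu>" "0 \<le> S"
    by (auto simp: eventually_at_top_linorder)
  \<comment> \<open>The sign is reversed because \<open>first_hitting_time\<close> concerns the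
    first rise to a level. Up to that time the radius is at least \<open>\<nu>\<close>, as
    \<open>polar_solution\<close> demands.\<close>
  have "continuous_on {0..S} (\<lambda>s. - polar_radius F r0 u s)"
    by (intro continuous_on_minus continuous_on_subset[OF polar_radius_continuous[OF lip traj r0]]) auto
  then obtain s where s: "0 \<le> s" "s \<le> S" "- polar_radius F r0 u s = - \<nu>"
    "\<And>r. 0 \<le> r \<Longrightarrow> r \<le> s \<Longrightarrow> - polar_radius F r0 u r \<le> - \<nu>"
    by (rule first_hitting_time[where c = "- \<nu>"]) (use S \<nu> in auto)
  have "x (polar_time \<alpha> F r0 t0 u s) = polar_radius F r0 u s *\<^sub>R u s"
    using x s by (intro polar_solution[OF lip traj r0 \<alpha> reg \<nu>(1)])
      (auto simp: ode_solution_on_def intro: has_vector_derivative_at_within)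
  then show thesis using that s by auto
qed

text \<open>A nonvanishing solution reaching past \<open>T\<close> would be bounded away from 0 on
  \<open>{t0..T}\<close>; for smaller \<open>\<nu>\<close> it would coincide with
  \<open>x\<nu> \<nu>\<close> up to the entry time, where the norm is \<open>\<nu>\<close>.
  Conversely, \<open>x\<nu> \<nu>\<close> with small enough \<open>\<nu>\<close> is itself a
  nonvanishing singular solution up to any given polar time.\<close>

lemma blowup_time_eq:
  assumes lim: "(polar_radius F r0 u \<longlongrightarrow> 0) at_top" "(polar_time \<alpha> F r0 t0 u \<longlongrightarrow> T) at_top"
      "\<And>s. 0 \<le> s \<Longrightarrow> polar_time \<alpha> F r0 t0 u s \<le> T"
    and x\<nu>: "\<And>\<nu>. \<nu> > 0 \<Longrightarrow> ode_solution_on (reg_field \<alpha> F G \<nu>) UNIV (x\<nu> \<nu>) \<and> x\<nu> \<nu> t0 = r0 *\<^sub>R u 0"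
    and blow: "is_blowup_time \<alpha> F t0 (r0 *\<^sub>R u 0) tb"
  shows "tb = T"
proof (rule antisym)
  let ?r = "polar_radius F r0 u" and ?t = "polar_time \<alpha> F r0 t0 u"
  have x\<nu>D: "(x\<nu> \<nu> has_vector_derivative reg_field \<alpha> F G \<nu> (x\<nu> \<nu> t)) (at t within A)" if "\<nu> > 0" for \<nu> t A
    using x\<nu>[OF that] by (auto simp: ode_solution_on_def intro: has_vector_derivative_at_within)
  show "tb \<le> T"
  proof (rule ccontr)
    assume "\<not> tb \<le> T"
    obtain x where x: "nonvanishing_solution \<alpha> F t0 (r0 *\<^sub>R u 0) tb x"
      using blow by (auto simp: is_blowup_time_def)
    have xD: "(x has_vector_derivative singular_field \<alpha> F (x t)) (at t within A)"
      if "t \<in> A" "A \<subseteq> {t0..T}" for t A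
      using x that \<open>\<not> tb \<le> T\<close> unfolding nonvanishing_solution_def ode_solution_on_def
      by (intro has_vector_derivative_within_subset[of x _ t "{t0..<tb}" A]) auto
    have t0T: "t0 \<le> T" using lim(3)[of 0] by simp
    have "continuous_on {t0..T} (\<lambda>t. norm (x t))"
      by (rule continuous_on_norm[OF continuous_on_vector_derivative[OF xD]]) auto
    then obtain tm where tm: "tm \<in> {t0..T}" "\<And>t. t \<in> {t0..T} \<Longrightarrow> norm (x tm) \<le> norm (x t)"
      using continuous_attains_inf[of "{t0..T}" "\<lambda>t. norm (x t)"] t0T by auto
    have "norm (x tm) > 0"
      using x tm(1) \<open>\<not> tb \<le> T\<close> by (auto simp: nonvanishing_solution_def)
    define \<nu> where "\<nu> = min (norm (x tm)) r0 / 2"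
    have \<nu>: "\<nu> > 0" "\<nu> < r0" "\<nu> < norm (x tm)"
      using \<open>norm (x tm) > 0\<close> r0 unfolding \<nu>_def by linarith+
    obtain s where s: "0 \<le> s" "x\<nu> \<nu> (?t s) = \<nu> *\<^sub>R u s"
      using polar_entry[OF lim(1) \<nu>(1,2), of "x\<nu> \<nu>"] x\<nu>[OF \<nu>(1)] by blast
    have ts: "?t s \<in> {t0..T}"
      using lim(3)[OF s(1)] polar_time_mono[OF lip traj r0 order_refl s(1), of \<alpha> t0] by simp
    have "x (?t s) = x\<nu> \<nu> (?t s)"
    proof (rule reg_field_solution_unique[OF \<alpha> reg \<nu>(1), where a = t0])
      fix t assume t: "t \<in> {t0..?t s}"
      have "reg_field \<alpha> F G \<nu> (x t) = singular_field \<alpha> F (x t)"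
        using tm(2)[of t] t ts \<nu> by (intro reg_field_eq_singular_field[OF reg]) auto
      then show "(x has_vector_derivative reg_field \<alpha> F G \<nu> (x t)) (at t within {t0..?t s})"
        using xD[OF t] ts by auto
    qed (use ts x x\<nu> \<nu> x\<nu>D in \<open>auto simp: nonvanishing_solution_def\<close>)
    then have "norm (x (?t s)) = \<nu>" using s \<nu> sphere_trajectoryD(2)[OF traj, of s] by simp
    with tm(2)[OF ts] \<nu>(3) show False by simp
  qed
  show "T \<le> tb"
  proof (rule ccontr)
    assume "\<not> T \<le> tb"
    then have "\<forall>\<^sub>F s in at_top. tb < ?t s \<and> 0 \<le> s"
      using order_tendstoD(1)[OF lim(2)] eventually_ge_at_top[of 0] by (intro eventually_conj) auto
    then obtain S where S: "tb < ?t S" "0 \<le> S" by (auto simp: eventually_at_top_linorder)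
    have "continuous_on {0..S} ?r"
      by (intro continuous_on_subset[OF polar_radius_continuous[OF lip traj r0]]) auto
    then obtain sm where sm: "sm \<in> {0..S}" "\<And>s. s \<in> {0..S} \<Longrightarrow> ?r sm \<le> ?r s"
      using continuous_attains_inf[of "{0..S}" ?r] S by auto
    \<comment> \<open>With the least polar radius up to \<open>S\<close> as its size, the
      regularization is not felt before the time \<open>?t S\<close>.\<close>
    define \<nu> where "\<nu> = ?r sm"
    have \<nu>: "\<nu> > 0" unfolding \<nu>_def by (rule polar_radius_pos[OF r0])
    have ge: "\<nu> \<le> norm (x\<nu> \<nu> t)" if t: "t \<in> {t0..?t S}" for t
    proof -
      have "continuous_on {0..S} ?t"
        by (intro continuous_on_subset[OF polar_time_continuous[OF lip traj r0]]) auto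
      then obtain s where s: "0 \<le> s" "s \<le> S" "?t s = t"
        using IVT'[of ?t 0 t S] t S by auto
      have "x\<nu> \<nu> (?t s) = ?r s *\<^sub>R u s"
        using x\<nu>[OF \<nu>] x\<nu>D[OF \<nu>] s sm by (intro polar_solution[OF lip traj r0 \<alpha> reg \<nu>]) (auto simp: \<nu>_def)
      then show ?thesis
        using s sm sphere_trajectoryD(2)[OF traj, of s] polar_radius_pos[OF r0, of F u s] by (auto simp: \<nu>_def)
    qed
    have "nonvanishing_solution \<alpha> F t0 (r0 *\<^sub>R u 0) (?t S) (x\<nu> \<nu>)"
      unfolding nonvanishing_solution_def ode_solution_on_def
    proof (intro conjI ballI)
      fix t assume "t \<in> {t0..<?t S}"
      then have "t \<in> {t0..?t S}" by simp
      from ge[OF this] show "x\<nu> \<nu> t \<noteq> 0" using \<nu> by auto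
      show "(x\<nu> \<nu> has_vector_derivative singular_field \<alpha> F (x\<nu> \<nu> t)) (at t within {t0..<?t S})"
        using x\<nu>D[OF \<nu>, of t] reg_field_eq_singular_field[OF reg \<nu> ge[OF \<open>t \<in> {t0..?t S}\<close>]] by simp
    qed (use x\<nu> \<nu> in auto)
    then show False using blow S(1) unfolding is_blowup_time_def by blast
  qed
qed

end

text \<open>Comparing with the regularization of size \<open>1/2\<close> instead of \<open>1\<close> avoids a case distinction on
  whether the solution leaves the unit ball tangentially.\<close>

lemma expelled_direction:
  fixes F G :: "real^'n \<Rightarrow> real^'n"
  assumes \<alpha>: "\<alpha> < 1" and reg: "regularization \<alpha> F G"
    and lip: "L-lipschitz_on (sphere 0 1) F" and traj: "sphere_trajectory F u"
    and X: "ode_solution_on (reg_field \<alpha> F G 1) UNIV X" and esc: "norm (X \<tau>e) = 1" "\<And>\<tau>. \<tau> > \<tau>e \<Longrightarrow> norm (X \<tau>) > 1"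
    and u0: "u 0 = X \<tau>e" and up: "(u \<longlongrightarrow> p) at_top" and \<delta>: "\<delta> > 0"
  obtains \<tau> where "\<tau> > \<tau>e" "norm (X \<tau>) > 1" "dist (X \<tau> /\<^sub>R norm (X \<tau>)) p < \<delta>"
proof -
  let ?r = "polar_radius F 1 u" and ?t = "polar_time \<alpha> F 1 \<tau>e u"
  have nu: "norm (u s) = 1" for s using sphere_trajectoryD(2)[OF traj, of s] by simp
  have ge: "norm (X \<tau>) \<ge> 1" if "\<tau> \<ge> \<tau>e" for \<tau>
    using esc that by (cases "\<tau> = \<tau>e") (auto simp: less_imp_le)
  have half: "(0::real) < 1/2" by simp
  have XD: "(X has_vector_derivative reg_field \<alpha> F G (1/2) (X \<tau>)) (at \<tau> within A)" if "\<tau> \<ge> \<tau>e" for \<tau> A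
  proof -
    have "reg_field \<alpha> F G 1 (X \<tau>) = reg_field \<alpha> F G (1/2) (X \<tau>)"
      using ge[OF that] reg_field_eq_singular_field[OF reg zero_less_one, of "X \<tau>"]
        reg_field_eq_singular_field[OF reg half, of "X \<tau>"] by simp
    moreover have "(X has_vector_derivative reg_field \<alpha> F G 1 (X \<tau>)) (at \<tau>)"
      using X by (simp add: ode_solution_on_def)
    ultimately show ?thesis by (simp add: has_vector_derivative_at_within)
  qed
  have sol: "X (?t S) = ?r S *\<^sub>R u S" if "0 \<le> S" "\<And>s. 0 \<le> s \<Longrightarrow> s \<le> S \<Longrightarrow> 1/2 \<le> ?r s" for S
    using that XD u0 by (intro polar_solution[OF lip traj zero_less_one \<alpha> reg half]) auto
  have t_ge: "\<tau>e \<le> ?t s" if "0 \<le> s" for s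
    using polar_time_mono[OF lip traj zero_less_one order_refl that, of \<alpha> \<tau>e] by simp
  \<comment> \<open>After \<open>\<tau>e\<close> the norm of \<open>X\<close> is at least 1, so
    \<open>X\<close> also solves the problem of size 1/2, and its polar form is valid while
    \<open>?r\<close> is at least 1/2. At a first time with \<open>?r = 1/2\<close> this form would
    give \<open>X\<close> the norm 1/2.\<close>
  have r_ge: "1/2 \<le> ?r S" if S: "0 \<le> S" for S
  proof (rule ccontr)
    assume "\<not> 1/2 \<le> ?r S"
    have "continuous_on {0..S} (\<lambda>s. - ?r s)"
      by (intro continuous_on_minus continuous_on_subset[OF polar_radius_continuous[OF lip traj zero_less_one]]) auto
    then obtain s where s: "0 \<le> s" "s \<le> S" "- ?r s = - (1/2)" "\<And>r. 0 \<le> r \<Longrightarrow> r \<le> s \<Longrightarrow> - ?r r \<le> - (1/2)"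
      by (rule first_hitting_time[where c = "- (1/2)"]) (use S \<open>\<not> 1/2 \<le> ?r S\<close> in auto)
    have "X (?t s) = ?r s *\<^sub>R u s"
      using s by (intro sol) auto
    then have "norm (X (?t s)) = 1/2" using s(3) nu[of s] by simp
    with ge[OF t_ge[OF s(1)]] show False by simp
  qed
  have "\<forall>\<^sub>F s in at_top. dist (u s) p < \<delta> \<and> 0 < s"
    using tendstoD[OF up \<delta>] eventually_gt_at_top[of 0] by (rule eventually_conj)
  then obtain s where s: "dist (u s) p < \<delta>" "0 < s" by (auto simp: eventually_at_top_linorder)
  show thesis
  proof
    show 1: "?t s > \<tau>e" using polar_time_strict_mono[OF lip traj zero_less_one order_refl s(2), of \<alpha> \<tau>e] by simp
    show "norm (X (?t s)) > 1" using esc(2)[OF 1] .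
    have "X (?t s) = ?r s *\<^sub>R u s" using sol r_ge s(2) by simp
    then have "X (?t s) /\<^sub>R norm (X (?t s)) = u s"
      using nu[of s] polar_radius_pos[of 1 F u s] by simp
    then show "dist (X (?t s) /\<^sub>R norm (X (?t s))) p < \<delta>" using s(1) by simp
  qed
qed

text \<open>Stability keeps the direction within \<open>\<epsilon>\<close> of \<open>p\<close>,
  where \<open>Fr\<close> is positive, so the radius never falls below its initial value and the
  polar form holds for all later times. Neither bound contains \<open>\<nu>\<close>, which allows
  the starting time and point to depend on it.\<close>

lemma expelled_asymptotics:
  fixes F G :: "real^'n \<Rightarrow> real^'n"
  assumes \<alpha>: "\<alpha> < 1" and reg: "regularization \<alpha> F G" and lip: "L-lipschitz_on (sphere 0 1) F"
    and stable: "\<And>u s. sphere_trajectory F u \<Longrightarrow> dist (u 0) p < \<delta> \<Longrightarrow> 0 \<le> s \<Longrightarrow> dist (u s) p < \<epsilon>"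
    and Fr: "\<And>y. y \<in> sphere 0 1 \<Longrightarrow> dist y p < \<epsilon> \<Longrightarrow> \<bar>Fr F y - a\<bar> \<le> \<eta>" and \<eta>: "\<eta> < a"
    and \<nu>: "\<nu> > 0" and x: "ode_solution_on (reg_field \<alpha> F G \<nu>) UNIV x"
    and x1: "\<nu> \<le> norm (x t1)" "dist (x t1 /\<^sub>R norm (x t1)) p < \<delta>" and t: "t1 \<le> t"
  shows "dist (x t /\<^sub>R norm (x t)) p < \<epsilon>"
    "\<bar>norm (x t) powr (1 - \<alpha>) - norm (x t1) powr (1 - \<alpha>) - (1 - \<alpha>) * a * (t - t1)\<bar> \<le> (1 - \<alpha>) * \<eta> * (t - t1)"
proof -
  define r1 where "r1 = norm (x t1)"
  have r1: "r1 > 0" unfolding r1_def using \<nu> x1(1) by linarith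
  then have "x t1 /\<^sub>R r1 \<in> sphere 0 1" by (simp add: r1_def)
  then obtain v where v: "sphere_trajectory F v" "v 0 = x t1 /\<^sub>R r1"
    using sphere_trajectory_exists[OF lip] by blast
  let ?r = "polar_radius F r1 v" and ?t = "polar_time \<alpha> F r1 t1 v"
  have nv: "norm (v s) = 1" for s using sphere_trajectoryD(2)[OF v(1), of s] by simp
  have near: "dist (v s) p < \<epsilon>" if "0 \<le> s" for s
    using stable[OF v(1) _ that] x1 v(2) by (simp add: r1_def)
  then have Frv: "\<bar>Fr F (v s) - a\<bar> \<le> \<eta>" if "0 \<le> s" for s
    using Fr[OF sphere_trajectoryD(2)[OF v(1)]] that by blast
  have "\<exists>s\<ge>0. ?t s = t" by (rule polar_expand_time[OF lip v(1) r1 \<alpha> \<eta> Frv t])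
  then obtain s where s: "s \<ge> 0" "?t s = t" by blast
  have "x (?t s) = ?r s *\<^sub>R v s"
    using x v(2) r1 x1(1) polar_expand_radius[OF lip v(1) r1 \<alpha> \<eta> Frv]
    by (intro polar_solution[OF lip v(1) r1 \<alpha> reg \<nu> s(1)])
       (auto simp: ode_solution_on_def r1_def intro: has_vector_derivative_at_within order_trans)
  then have xt: "x t = ?r s *\<^sub>R v s" using s by simp
  have rpos: "?r s > 0" by (rule polar_radius_pos[OF r1])
  then have nx: "norm (x t) = ?r s" using nv xt by simp
  show "dist (x t /\<^sub>R norm (x t)) p < \<epsilon>" using near[OF s(1)] rpos xt nx by simp
  show "\<bar>norm (x t) powr (1 - \<alpha>) - norm (x t1) powr (1 - \<alpha>) - (1 - \<alpha>) * a * (t - t1)\<bar> \<le> (1 - \<alpha>) * \<eta> * (t - t1)"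
    using polar_expand_radius_time[OF lip v(1) r1 \<alpha> \<eta> Frv s(1), of t1] s(2) nx by (simp add: r1_def)
qed

section \<open>Passage to the limit\<close>

lemma tendsto_polar:
  fixes x :: "'b \<Rightarrow> 'a::real_normed_vector"
  assumes "\<alpha> < 1" "c > 0" "((\<lambda>\<nu>. norm (x \<nu>) powr (1 - \<alpha>)) \<longlongrightarrow> c) A"
    "((\<lambda>\<nu>. x \<nu> /\<^sub>R norm (x \<nu>)) \<longlongrightarrow> p) A"
  shows "(x \<longlongrightarrow> (c powr (1 / (1 - \<alpha>))) *\<^sub>R p) A"
proof -
  have "((\<lambda>\<nu>. (norm (x \<nu>) powr (1 - \<alpha>)) powr (1 / (1 - \<alpha>)) *\<^sub>R (x \<nu> /\<^sub>R norm (x \<nu>))) \<longlongrightarrow>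
      (c powr (1 / (1 - \<alpha>))) *\<^sub>R p) A"
    using assms by (intro tendsto_scaleR tendsto_powr tendsto_const) auto
  \<comment> \<open>For \<open>x \<nu> = 0\<close> both sides are 0, because
    \<open>inverse 0 = 0\<close>.\<close>
  moreover have "(norm (x \<nu>) powr (1 - \<alpha>)) powr (1 / (1 - \<alpha>)) *\<^sub>R (x \<nu> /\<^sub>R norm (x \<nu>)) = x \<nu>" for \<nu>
    using assms(1) by (cases "x \<nu> = 0") (auto simp: powr_powr)
  ultimately show ?thesis by simp
qed

theorem theorem4:
  fixes \<alpha> t0 r0 tb :: real
    and F G :: "real ^ 'n \<Rightarrow> real ^ 'n"
    and ystar ystar' ystar_esc y0 x0 :: "real ^ 'n"
    and x\<nu> :: "real \<Rightarrow> real \<Rightarrow> real ^ 'n"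
  assumes "\<alpha> < 1"
    and "C1_on_set (sphere 0 1) F"
    and "regularization \<alpha> F G"
    and "attractor F {ystar}"
    and "Fr F ystar < 0"
    and "r0 > 0"
    and "y0 \<in> basin F {ystar}"
    and "x0 = r0 *\<^sub>R y0"
    and "\<And>\<nu>. \<nu> > 0 \<Longrightarrow> ode_solution_on (reg_field \<alpha> F G \<nu>) UNIV (x\<nu> \<nu>) \<and> x\<nu> \<nu> t0 = x0"
    and "is_blowup_time \<alpha> F t0 x0 tb"
    and "locally_expelling \<alpha> F G ystar"
    and "expelled_at \<alpha> F G (tau_ent \<alpha> F ystar) ystar ystar_esc"
    and "attractor F {ystar'}"
    and "Fs F ystar' = 0"
    and "Fr F ystar' > 0"
    and "ystar_esc \<in> basin F {ystar'}"
  shows "\<forall>t>tb. ((\<lambda>\<nu>. x\<nu> \<nu> t) \<longlongrightarrow>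
           (((1 - \<alpha>) * Fr F ystar' * (t - tb)) powr (1 / (1 - \<alpha>))) *\<^sub>R ystar') (at_right 0)"
proof -
  note \<alpha> = assms(1) and reg = assms(3) and r0 = assms(6)
  let ?a = "Fr F ystar'" and ?\<tau>0 = "tau_ent \<alpha> F ystar"
  obtain L where lip: "L-lipschitz_on (sphere 0 1) F" using F_lipschitz_on_sphere[OF \<alpha> reg] .
  obtain L1 where L1: "L1-lipschitz_on UNIV (reg_field \<alpha> F G 1)" using reg_field_1_lipschitz[OF \<alpha> reg] .
  obtain u where u: "sphere_trajectory F u" "u 0 = y0" "(u \<longlongrightarrow> ystar) at_top"
    using basin_pointE[OF assms(7)] .
  let ?r = "polar_radius F r0 u" and ?t = "polar_time \<alpha> F r0 t0 u"
  obtain T where T: "(?r \<longlongrightarrow> 0) at_top" "(?t \<longlongrightarrow> T) at_top" "\<And>s. 0 \<le> s \<Longrightarrow> ?t s \<le> T"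
    by (rule polar_collapse[where ?t1.0 = t0, OF lip u(1) r0 \<alpha> u(3) assms(5)]) blast
  have x\<nu>: "ode_solution_on (reg_field \<alpha> F G \<nu>) UNIV (x\<nu> \<nu>)" "x\<nu> \<nu> t0 = r0 *\<^sub>R u 0" if "\<nu> > 0" for \<nu>
    using assms(8,9) that u(2) by auto
  have "tb = T"
    using blowup_time_eq[OF \<alpha> reg lip u(1) r0 T, of x\<nu> tb] x\<nu> assms(8,10) u(2) by simp
  have "\<exists>s. 0 < \<nu> \<longrightarrow> \<nu> < r0 \<longrightarrow> 0 \<le> s \<and> ?r s = \<nu> \<and> x\<nu> \<nu> (?t s) = \<nu> *\<^sub>R u s" for \<nu>
    using polar_entry[OF \<alpha> reg lip u(1) r0 T(1) _ _ x\<nu>, of \<nu>] by blast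
  then obtain \<sigma> where \<sigma>: "\<And>\<nu>. 0 < \<nu> \<Longrightarrow> \<nu> < r0 \<Longrightarrow>
      0 \<le> \<sigma> \<nu> \<and> ?r (\<sigma> \<nu>) = \<nu> \<and> x\<nu> \<nu> (?t (\<sigma> \<nu>)) = \<nu> *\<^sub>R u (\<sigma> \<nu>)"
    by metis
  have small: "\<forall>\<^sub>F \<nu> in at_right 0. 0 < \<nu> \<and> \<nu> < c" if "c > 0" for c :: real
    using that by (auto simp: eventually_at_right_field)
  \<comment> \<open>On a bounded interval of trajectory times the radius has a positive minimum, so
    a smaller \<open>\<nu>\<close> is reached only later.\<close>
  have \<sigma>_lim: "filterlim \<sigma> at_top (at_right 0)"
    unfolding filterlim_at_top
  proof
    fix S :: real
    have "continuous_on {0..max 0 S} ?r"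
      by (intro continuous_on_subset[OF polar_radius_continuous[OF lip u(1) r0]]) auto
    then obtain sm where sm: "sm \<in> {0..max 0 S}" "\<And>s. s \<in> {0..max 0 S} \<Longrightarrow> ?r sm \<le> ?r s"
      using continuous_attains_inf[of "{0..max 0 S}" ?r] by auto
    have "min r0 (?r sm) > 0" using r0 polar_radius_pos[OF r0, of F u sm] by simp
    from small[OF this] show "\<forall>\<^sub>F \<nu> in at_right 0. S \<le> \<sigma> \<nu>"
    proof eventually_elim
      case (elim \<nu>)
      show ?case
      proof (rule ccontr)
        assume "\<not> S \<le> \<sigma> \<nu>"
        then have "\<sigma> \<nu> \<in> {0..max 0 S}" using \<sigma>[of \<nu>] elim by auto
        from sm(2)[OF this] show False using \<sigma>[of \<nu>] elim by simp
      qed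
    qed
  qed
  have u_lim: "((\<lambda>\<nu>. u (\<sigma> \<nu>)) \<longlongrightarrow> ystar) (at_right 0)"
    by (rule filterlim_compose[OF u(3) \<sigma>_lim])
  have t_lim: "((\<lambda>\<nu>. ?t (\<sigma> \<nu>)) \<longlongrightarrow> tb) (at_right 0)"
    unfolding \<open>tb = T\<close> by (rule filterlim_compose[OF T(2) \<sigma>_lim])
  obtain X \<tau>e where X: "ode_solution_on (reg_field \<alpha> F G 1) UNIV X" "X ?\<tau>0 = ystar" "\<tau>e > ?\<tau>0"
    "norm (X \<tau>e) = 1" "\<And>\<tau>. \<tau> > \<tau>e \<Longrightarrow> norm (X \<tau>) > 1" "ystar_esc = X \<tau>e"
    using assms(12) unfolding expelled_at_def rescaled_field_eq_reg_field by blast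
  obtain u' where u': "sphere_trajectory F u'" "u' 0 = X \<tau>e" "(u' \<longlongrightarrow> ystar') at_top"
    using basin_pointE[OF assms(16)] X(6) by blast
  have ystar': "ystar' \<in> sphere 0 1" using assms(13) by (simp add: attractor_def)
  show ?thesis
  proof (intro allI impI)
    fix t assume t: "tb < t"
    let ?c = "(1 - \<alpha>) * ?a * (t - tb)"
    have key: "\<forall>\<^sub>F \<nu> in at_right 0. dist (x\<nu> \<nu> t /\<^sub>R norm (x\<nu> \<nu> t)) ystar' < \<eta> \<and>
        \<bar>norm (x\<nu> \<nu> t) powr (1 - \<alpha>) - ?c\<bar> < \<eta> * ((1 - \<alpha>) * (t - tb) + 1)" if \<eta>: "0 < \<eta>" "\<eta> < ?a" for \<eta>
    proof -
      obtain \<epsilon> where \<epsilon>: "\<epsilon> > 0" "\<epsilon> \<le> \<eta>"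
        "\<And>y. y \<in> sphere 0 1 \<Longrightarrow> dist y ystar' < \<epsilon> \<Longrightarrow> \<bar>Fr F y - ?a\<bar> \<le> \<eta>"
      proof -
        obtain e where e: "e > 0" "\<And>y. y \<in> sphere 0 1 \<Longrightarrow> dist y ystar' < e \<Longrightarrow> dist (Fr F y) ?a < \<eta>"
          using Fr_continuous_on_sphere[OF lip] ystar' \<eta>(1) unfolding continuous_on_iff by blast
        show thesis
          by (rule that[of "min e \<eta>"]) (use e \<eta> in \<open>auto simp: dist_real_def less_imp_le\<close>)
      qed
      obtain \<delta> where \<delta>: "\<delta> > 0"
        "\<And>u s. sphere_trajectory F u \<Longrightarrow> dist (u 0) ystar' < \<delta> \<Longrightarrow> 0 \<le> s \<Longrightarrow> dist (u s) ystar' < \<epsilon>"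
        using point_attractor_stable[OF lip assms(13,14) \<epsilon>(1)] by blast
      \<comment> \<open>The time \<open>\<tau>1\<close> is chosen independently of
        \<open>\<nu>\<close>, so the Gronwall factor between \<open>?\<tau>0\<close> and
        \<open>\<tau>1\<close> is a constant and the corresponding physical time
        \<open>t1 \<nu>\<close> tends to \<open>tb\<close>.\<close>
      obtain \<tau>1 where \<tau>1: "\<tau>1 > \<tau>e" "norm (X \<tau>1) > 1" "dist (X \<tau>1 /\<^sub>R norm (X \<tau>1)) ystar' < \<delta>"
        using expelled_direction[OF \<alpha> reg lip u'(1) X(1,4,5) u'(2,3) \<delta>(1)] .
      have X0: "X \<tau>1 \<noteq> 0" using \<tau>1(2) by auto
      define t1 where "t1 = (\<lambda>\<nu>. ?t (\<sigma> \<nu>) + \<nu> powr (1 - \<alpha>) * (\<tau>1 - ?\<tau>0))"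
      define Y where "Y = (\<lambda>\<nu>. x\<nu> \<nu> (t1 \<nu>) /\<^sub>R \<nu>)"
      \<comment> \<open>At the rescaled time \<open>?\<tau>0\<close> the rescaled regularized
        solution is at \<open>u (\<sigma> \<nu>)\<close> and \<open>X\<close> is at
        \<open>ystar\<close>; both solve the same Lipschitz equation.\<close>
      have "norm (Y \<nu> - X \<tau>1) \<le> exp (L1 * 1 * (\<tau>1 - ?\<tau>0)) * norm (u (\<sigma> \<nu>) - ystar)"
        if \<nu>: "0 < \<nu> \<and> \<nu> < r0" for \<nu>
      proof -
        let ?X = "\<lambda>\<tau>. x\<nu> \<nu> (?t (\<sigma> \<nu>) + \<nu> powr (1 - \<alpha>) * (\<tau> - ?\<tau>0)) /\<^sub>R \<nu>"
        have "norm (?X \<tau>1 - X \<tau>1) \<le> exp (L1 * 1 * (\<tau>1 - ?\<tau>0)) * norm (?X ?\<tau>0 - X ?\<tau>0)"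
          by (rule gronwall_lipschitz[OF L1, where c = "\<lambda>_. 1"])
             (use rescaled_solution[OF _ x\<nu>(1), of \<nu> "?t (\<sigma> \<nu>)" ?\<tau>0] \<nu> X(1,3) \<tau>1(1) in
               \<open>auto simp: ode_solution_on_def intro: has_vector_derivative_at_within\<close>)
        then show ?thesis using \<sigma>[of \<nu>] \<nu> X(2) by (simp add: Y_def t1_def)
      qed
      then have "\<forall>\<^sub>F \<nu> in at_right 0. norm (Y \<nu> - X \<tau>1) \<le> exp (L1 * 1 * (\<tau>1 - ?\<tau>0)) * norm (u (\<sigma> \<nu>) - ystar)"
        using small[OF r0] by (auto elim: eventually_mono)
      then have "((\<lambda>\<nu>. Y \<nu> - X \<tau>1) \<longlongrightarrow> 0) (at_right 0)"
        by (rule Lim_null_comparison) (intro tendsto_mult_right_zero tendsto_norm_zero LIM_zero u_lim)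
      then have Y_lim: "(Y \<longlongrightarrow> X \<tau>1) (at_right 0)" by (rule LIM_zero_cancel)
      have p_lim: "((\<lambda>\<nu>::real. \<nu> powr (1 - \<alpha>)) \<longlongrightarrow> 0 powr (1 - \<alpha>)) (at_right 0)"
        using \<alpha> small[of 1] by (intro tendsto_powr2 tendsto_ident_at tendsto_const) (auto elim!: eventually_mono)
      have w_lim: "((\<lambda>\<nu>. \<nu> powr (1 - \<alpha>) * norm (Y \<nu>) powr (1 - \<alpha>)) \<longlongrightarrow> 0) (at_right 0)"
        using tendsto_mult[OF p_lim tendsto_powr[OF tendsto_norm[OF Y_lim] tendsto_const[of "1 - \<alpha>"]]] X0 by simp
      have t1_lim: "(t1 \<longlongrightarrow> tb) (at_right 0)"
        unfolding t1_def using tendsto_add[OF t_lim tendsto_mult[OF p_lim tendsto_const[of "\<tau>1 - ?\<tau>0"]]] by simp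
      \<comment> \<open>This will bound the radial error at time \<open>t\<close>. Its limit
        \<open>(1 - \<alpha>) * \<eta> * (t - tb)\<close> lies below the required bound by
        \<open>\<eta>\<close>, which is the purpose of the summand 1 in \<open>key\<close>.\<close>
      let ?E = "\<lambda>\<nu>. \<bar>\<nu> powr (1 - \<alpha>) * norm (Y \<nu>) powr (1 - \<alpha>) + (1 - \<alpha>) * ?a * (tb - t1 \<nu>)\<bar> + (1 - \<alpha>) * \<eta> * (t - t1 \<nu>)"
      have "(?E \<longlongrightarrow> \<bar>0 + (1 - \<alpha>) * ?a * (tb - tb)\<bar> + (1 - \<alpha>) * \<eta> * (t - tb)) (at_right 0)"
        by (intro tendsto_intros w_lim t1_lim)
      then have ev_E: "\<forall>\<^sub>F \<nu> in at_right 0. ?E \<nu> < \<eta> * ((1 - \<alpha>) * (t - tb) + 1)"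
        by (rule order_tendstoD(2)) (use \<eta> in \<open>simp add: algebra_simps\<close>)
      have "((\<lambda>\<nu>. Y \<nu> /\<^sub>R norm (Y \<nu>)) \<longlongrightarrow> X \<tau>1 /\<^sub>R norm (X \<tau>1)) (at_right 0)"
        using X0 by (intro tendsto_intros Y_lim) auto
      then have ev_dir: "\<forall>\<^sub>F \<nu> in at_right 0. dist (Y \<nu> /\<^sub>R norm (Y \<nu>)) ystar' < \<delta>"
        by (rule order_tendstoD(2)[OF tendsto_dist[OF _ tendsto_const] \<tau>1(3)])
      have ev_norm: "\<forall>\<^sub>F \<nu> in at_right 0. 1 < norm (Y \<nu>)"
        by (rule order_tendstoD(1)[OF tendsto_norm[OF Y_lim] \<tau>1(2)])
      have ev_t: "\<forall>\<^sub>F \<nu> in at_right 0. t1 \<nu> < t" by (rule order_tendstoD(2)[OF t1_lim t])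
      from small[OF zero_less_one] ev_E ev_dir ev_norm ev_t show ?thesis
      proof eventually_elim
        case (elim \<nu>)
        have \<nu>: "\<nu> > 0" using elim by simp
        have xY: "x\<nu> \<nu> (t1 \<nu>) = \<nu> *\<^sub>R Y \<nu>" using \<nu> by (simp add: Y_def)
        have n1: "\<nu> \<le> norm (x\<nu> \<nu> (t1 \<nu>))"
          using xY \<nu> elim(4) by (simp add: mult_le_cancel_left1)
        have "inverse (norm (\<nu> *\<^sub>R Y \<nu>)) * \<nu> = inverse (norm (Y \<nu>))"
          using \<nu> by (simp add: field_simps)
        then have n2: "dist (x\<nu> \<nu> (t1 \<nu>) /\<^sub>R norm (x\<nu> \<nu> (t1 \<nu>))) ystar' < \<delta>"
          using elim(3) unfolding xY scaleR_scaleR by (simp only:)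
        note asym = expelled_asymptotics[where x = "x\<nu> \<nu>" and t = t and ?t1.0 = "t1 \<nu>" and \<epsilon> = \<epsilon>,
            OF \<alpha> reg lip _ _ \<eta>(2) \<nu> x\<nu>(1)[OF \<nu>] n1 n2 less_imp_le[OF elim(5)]]
        have dir: "dist (x\<nu> \<nu> t /\<^sub>R norm (x\<nu> \<nu> t)) ystar' < \<epsilon>"
          by (rule asym(1)) (blast intro: \<delta>(2) \<epsilon>(3))+
        have rad: "\<bar>norm (x\<nu> \<nu> t) powr (1 - \<alpha>) - norm (x\<nu> \<nu> (t1 \<nu>)) powr (1 - \<alpha>) - (1 - \<alpha>) * ?a * (t - t1 \<nu>)\<bar>
            \<le> (1 - \<alpha>) * \<eta> * (t - t1 \<nu>)"
          by (rule asym(2)) (blast intro: \<delta>(2) \<epsilon>(3))+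
        have pw: "norm (x\<nu> \<nu> (t1 \<nu>)) powr (1 - \<alpha>) = \<nu> powr (1 - \<alpha>) * norm (Y \<nu>) powr (1 - \<alpha>)"
          using xY \<nu> by (simp add: powr_mult)
        \<comment> \<open>The first bracket is controlled by \<open>rad\<close>; the second collects
          the radius at time \<open>t1 \<nu>\<close> and the replacement of \<open>t1 \<nu>\<close>
          by \<open>tb\<close>, and tends to 0.\<close>
        have eq: "norm (x\<nu> \<nu> t) powr (1 - \<alpha>) - ?c =
            (norm (x\<nu> \<nu> t) powr (1 - \<alpha>) - norm (x\<nu> \<nu> (t1 \<nu>)) powr (1 - \<alpha>) - (1 - \<alpha>) * ?a * (t - t1 \<nu>))
            + (\<nu> powr (1 - \<alpha>) * norm (Y \<nu>) powr (1 - \<alpha>) + (1 - \<alpha>) * ?a * (tb - t1 \<nu>))"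
          unfolding pw by (simp add: algebra_simps)
        have "\<bar>norm (x\<nu> \<nu> t) powr (1 - \<alpha>) - ?c\<bar> \<le> ?E \<nu>"
          unfolding eq using rad by linarith
        also have "\<dots> < \<eta> * ((1 - \<alpha>) * (t - tb) + 1)" by (rule elim(2))
        finally show ?case using dir \<epsilon>(2) by auto
      qed
    qed
    have ev: "\<forall>\<^sub>F \<nu> in at_right 0. dist (x\<nu> \<nu> t /\<^sub>R norm (x\<nu> \<nu> t)) ystar' < e \<and>
        dist (norm (x\<nu> \<nu> t) powr (1 - \<alpha>)) ?c < e" if e: "e > 0" for e
    proof -
      let ?M = "(1 - \<alpha>) * (t - tb) + 1"
      have M: "?M \<ge> 1" using \<alpha> t by simp
      \<comment> \<open>Since \<open>?M \<ge> 1\<close>, this choice makes both tolerances of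
        \<open>key\<close>, \<open>\<eta>\<close> and \<open>\<eta> * ?M\<close>, at most
        \<open>e\<close>, and it keeps \<open>\<eta>\<close> below \<open>?a\<close>.\<close>
      define \<eta> where "\<eta> = min (?a / 2) (e / ?M)"
      have \<eta>: "0 < \<eta>" "\<eta> < ?a" "\<eta> \<le> e / ?M" using assms(15) e M by (auto simp: \<eta>_def)
      have "\<eta> * ?M \<le> e" using \<eta>(3) M by (simp add: le_divide_eq)
      moreover have "\<eta> \<le> \<eta> * ?M" using \<eta>(1) M by (simp add: mult_le_cancel_left1)
      ultimately show ?thesis
        by (intro eventually_mono[OF key[OF \<eta>(1,2)]]) (auto simp: dist_real_def)
    qed
    have "?c > 0" using \<alpha> t assms(15) by simp
    then show "((\<lambda>\<nu>. x\<nu> \<nu> t) \<longlongrightarrow> (?c powr (1 / (1 - \<alpha>))) *\<^sub>R ystar') (at_right 0)"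
    proof (rule tendsto_polar[OF \<alpha>])
      show "((\<lambda>\<nu>. norm (x\<nu> \<nu> t) powr (1 - \<alpha>)) \<longlongrightarrow> ?c) (at_right 0)"
        by (rule tendstoI, rule eventually_mono[OF ev]) auto
      show "((\<lambda>\<nu>. x\<nu> \<nu> t /\<^sub>R norm (x\<nu> \<nu> t)) \<longlongrightarrow> ystar') (at_right 0)"
        by (rule tendstoI, rule eventually_mono[OF ev]) auto
    qed
  qed
qed

end
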